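(* Let $X$ be a complex Banach space and let $(T(t))_{t\geq 0}$ be a differentiable $C_0$ semigroup on $X$ with infinitesimal generator $A$. Then for every $t>0$, $$\sigma(AT(t))\cup\{0\}=\{\lambda e^{\lambda t} : \lambda\in\sigma(A)\cup\{0\}\},$$ $$\sigma_{ap}(AT(t))\cup\{0\}=\{\lambda e^{\lambda t} : \lambda\in\sigma_{ap}(A)\cup\{0\}\}.$$
   Context: A $C_0$ semigroup $(T(t))_{t\ge 0}$ is differentiable if for every $x\in X$ the map $t\mapsto T(t)x$ is differentiable for $t>0$ (in that case $AT(t)$ is a bounded operator on $X$ for every $t>0$). $\sigma$ denotes the spectrum and $\sigma_{ap}$ the approximate point spectrum: for a closed operator $S$ with domain $D(S)$, $\lambda\in\sigma_{ap}(S)$ iff there is a sequence $(x_n)\subset D(S)$ with $\|x_n\|=1$ and $(\lambda-S)x_n\to 0$. *)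

theory Defs
  imports "HOL-Analysis.Analysis"
begin

text \<open>The library only has real normed spaces; the complex structure is an extra scalar
  multiplication extending the real one.  The unit law follows from \<open>scaleR_scaleC\<close>.\<close>

class complex_normed_vector = real_normed_vector +
  fixes scaleC :: "complex \<Rightarrow> 'a \<Rightarrow> 'a"  (infixr \<open>*\<^sub>C\<close> 75)
  assumes scaleR_scaleC: "r *\<^sub>R x = complex_of_real r *\<^sub>C x"
    and scaleC_add_right: "c *\<^sub>C (x + y) = c *\<^sub>C x + c *\<^sub>C y"
    and scaleC_add_left: "(c + d) *\<^sub>C x = c *\<^sub>C x + d *\<^sub>C x"
    and scaleC_scaleC: "c *\<^sub>C d *\<^sub>C x = (c * d) *\<^sub>C x"
    and norm_scaleC: "norm (c *\<^sub>C x) = cmod c * norm x"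

class complex_banach = complex_normed_vector + banach

instantiation complex :: complex_banach
begin

definition scaleC_complex :: "complex \<Rightarrow> complex \<Rightarrow> complex"
  where "scaleC_complex c x = c * x"

instance
  by standard (simp_all add: scaleC_complex_def scaleR_conv_of_real algebra_simps norm_mult)

end

definition bounded_clinear :: "('a::complex_normed_vector \<Rightarrow> 'a) \<Rightarrow> bool"
  where "bounded_clinear f \<longleftrightarrow> bounded_linear f \<and> (\<forall>c x. f (c *\<^sub>C x) = c *\<^sub>C f x)"

text \<open>A possibly unbounded operator is given by its domain \<open>D\<close> and a function \<open>S\<close> of which only
  the values on \<open>D\<close> matter.\<close>

definition resolvent_set :: "'a::complex_normed_vector set \<Rightarrow> ('a \<Rightarrow> 'a) \<Rightarrow> complex set"
  where "resolvent_set D S =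
    {l. bij_betw (\<lambda>x. l *\<^sub>C x - S x) D UNIV \<and>
        bounded_clinear (inv_into D (\<lambda>x. l *\<^sub>C x - S x))}"

definition spectrum :: "'a::complex_normed_vector set \<Rightarrow> ('a \<Rightarrow> 'a) \<Rightarrow> complex set"
  where "spectrum D S = - resolvent_set D S"

definition approx_point_spectrum :: "'a::complex_normed_vector set \<Rightarrow> ('a \<Rightarrow> 'a) \<Rightarrow> complex set"
  where "approx_point_spectrum D S =
    {l. \<exists>x :: nat \<Rightarrow> 'a. (\<forall>n. x n \<in> D \<and> norm (x n) = 1) \<and>
          (\<lambda>n. l *\<^sub>C x n - S (x n)) \<longlonglongrightarrow> 0}"

text \<open>Only the values \<open>T t\<close> with \<open>t \<ge> 0\<close> are constrained.\<close>

definition C0_semigroup :: "(real \<Rightarrow> 'a::complex_normed_vector \<Rightarrow> 'a) \<Rightarrow> bool"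
  where "C0_semigroup T \<longleftrightarrow>
    (\<forall>t\<ge>0. bounded_clinear (T t)) \<and>
    (\<forall>x. T 0 x = x) \<and>
    (\<forall>s\<ge>0. \<forall>t\<ge>0. \<forall>x. T (s + t) x = T s (T t x)) \<and>
    (\<forall>x. ((\<lambda>t. T t x) \<longlongrightarrow> x) (at_right 0))"

definition differentiable_semigroup :: "(real \<Rightarrow> 'a::complex_normed_vector \<Rightarrow> 'a) \<Rightarrow> bool"
  where "differentiable_semigroup T \<longleftrightarrow>
    C0_semigroup T \<and> (\<forall>x. \<forall>t>0. (\<lambda>s. T s x) differentiable (at t))"

definition generator_dom :: "(real \<Rightarrow> 'a::complex_normed_vector \<Rightarrow> 'a) \<Rightarrow> 'a set"
  where "generator_dom T =
    {x. \<exists>y. ((\<lambda>h. (T h x - x) /\<^sub>R h) \<longlongrightarrow> y) (at_right 0)}"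

definition generator :: "(real \<Rightarrow> 'a::complex_normed_vector \<Rightarrow> 'a) \<Rightarrow> 'a \<Rightarrow> 'a"
  where "generator T x = Lim (at_right 0) (\<lambda>h. (T h x - x) /\<^sub>R h)"

text \<open>The product \<open>A B\<close> of an operator \<open>A\<close> with domain \<open>D\<close> and an everywhere defined \<open>B\<close>
  has the function \<open>A \<circ> B\<close> and the following domain.\<close>

definition comp_dom :: "'a set \<Rightarrow> ('a \<Rightarrow> 'a) \<Rightarrow> 'a set"
  where "comp_dom D B = {x. B x \<in> D}"

end

theory Submission
  imports Defs "HOL-Complex_Analysis.Complex_Analysis"
begin

text \<open>
  Write \<open>B = A T(t)\<close>, which is bounded by the uniform boundedness principle.  For a bounded operator
  \<open>P\<close> commuting with the semigroup, variation of constants gives a bounded \<open>J\<close> with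
  \<open>J (A - P) x = T(t) x - exp(t P) x\<close> on the domain of \<open>A\<close>.  With \<open>P = l\<close> a scalar,
  \<open>l exp(l t) - B\<close> becomes a multiple of \<open>l - A\<close>, which gives one inclusion for both spectra.

  For the other one let \<open>m \<noteq> 0\<close> and \<open>G = A B / m\<close>, a bounded operator that agrees with \<open>A\<close> up to a
  multiple of \<open>B - m\<close>.  The case \<open>P = G\<close> shows that \<open>G exp(t G) - m\<close> is a multiple of \<open>B - m\<close>.  The
  entire function \<open>f(z) = z exp(t z) - m\<close> has finitely many zeros in a disc of radius larger than
  the norm of \<open>G\<close>; let \<open>p\<close> be the product of the factors \<open>z - a\<close> over these zeros with
  multiplicity.  Then \<open>p = f h\<close> with \<open>h\<close> holomorphic on the disc, so \<open>p(G) = h(G) f(G)\<close> is a multiple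
  of \<open>B - m\<close>.  Hence approximate eigenvectors of \<open>B\<close> at \<open>m\<close> yield approximate eigenvectors of \<open>G\<close>, and
  therefore of \<open>A\<close>, at some zero of \<open>f\<close>; and if all zeros of \<open>f\<close> lie in the resolvent set of \<open>A\<close>, then
  \<open>B - m\<close> divides \<open>1\<close> in the algebra of bounded operators commuting with the semigroup.
\<close>

subsection \<open>Bounded operators\<close>

interpretation cvec: vector_space "scaleC :: complex \<Rightarrow> 'a::complex_normed_vector \<Rightarrow> 'a"
proof
  fix x :: 'a
  show "1 *\<^sub>C x = x"
    using scaleR_scaleC[of 1 x] by simp
qed (simp_all add: scaleC_add_right scaleC_add_left scaleC_scaleC)

lemma bounded_clinearI:
  assumes "\<And>x y. f (x + y) = f x + f y" "\<And>c x. f (c *\<^sub>C x) = c *\<^sub>C f x"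
    "\<And>x. norm (f x) \<le> K * norm x"
  shows "bounded_clinear f"
  unfolding bounded_clinear_def
  using assms by (auto intro!: bounded_linear_intro[where K = K] simp: scaleR_scaleC mult.commute)

lemma bounded_clinear_bounded_linear: "bounded_clinear f \<Longrightarrow> bounded_linear f"
  by (simp add: bounded_clinear_def)

lemma bounded_clinear_bound:
  assumes "bounded_clinear f"
  obtains K where "K > 0" "\<And>x. norm (f x) \<le> K * norm x"
  using bounded_linear.pos_bounded[OF bounded_clinear_bounded_linear[OF assms]]
  by (auto simp: mult.commute)

lemma
  assumes "bounded_clinear f"
  shows bounded_clinear_add: "f (x + y) = f x + f y"
    and bounded_clinear_diff: "f (x - y) = f x - f y"
    and bounded_clinear_minus: "f (- x) = - f x"
    and bounded_clinear_zero: "f 0 = 0"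
    and bounded_clinear_scaleC: "f (c *\<^sub>C x) = c *\<^sub>C f x"
proof -
  interpret bounded_linear f
    using assms by (simp add: bounded_clinear_def)
  show "f (x + y) = f x + f y" "f (x - y) = f x - f y" "f (- x) = - f x" "f 0 = 0"
    by (rule add diff neg zero)+
  show "f (c *\<^sub>C x) = c *\<^sub>C f x"
    using assms by (simp add: bounded_clinear_def)
qed

lemmas bounded_clinear_simps = bounded_clinear_add bounded_clinear_diff bounded_clinear_minus
  bounded_clinear_zero bounded_clinear_scaleC

lemma bounded_clinear_tendsto:
  assumes "bounded_clinear f" "(g \<longlongrightarrow> l) F"
  shows "((\<lambda>x. f (g x)) \<longlongrightarrow> f l) F"
  using bounded_linear.tendsto[OF bounded_clinear_bounded_linear] assms by blast

lemma bounded_clinear_id: "bounded_clinear (\<lambda>x. x)"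
  by (intro bounded_clinearI[where K = 1]) auto

lemma bounded_clinear_const_scaleC:
  fixes f :: "'a::complex_normed_vector \<Rightarrow> 'a"
  assumes "bounded_clinear f"
  shows "bounded_clinear (\<lambda>x. c *\<^sub>C f x)"
proof -
  obtain K where K: "\<And>x. norm (f x) \<le> K * norm x"
    using bounded_clinear_bound assms by metis
  show ?thesis
  proof (rule bounded_clinearI[where K = "cmod c * K"])
    show "norm (c *\<^sub>C f x) \<le> cmod c * K * norm x" for x
      using mult_left_mono[OF K[of x], of "cmod c"] by (simp add: norm_scaleC mult.assoc)
  qed (simp_all add: bounded_clinear_simps[OF assms] cvec.scale_right_distrib mult.commute)
qed

lemma bounded_clinear_scaleC_right: "bounded_clinear (\<lambda>x. c *\<^sub>C x)"
  by (rule bounded_clinear_const_scaleC[OF bounded_clinear_id])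

lemma bounded_clinear_plus:
  fixes f g :: "'a::complex_normed_vector \<Rightarrow> 'a"
  assumes "bounded_clinear f" "bounded_clinear g"
  shows "bounded_clinear (\<lambda>x. f x + g x)"
  using assms unfolding bounded_clinear_def
  by (auto intro: bounded_linear_add simp: cvec.scale_right_distrib)

lemma bounded_clinear_compose:
  assumes "bounded_clinear f" "bounded_clinear g"
  shows "bounded_clinear (\<lambda>x. f (g x))"
  using assms unfolding bounded_clinear_def by (auto intro: bounded_linear_compose)

lemma bounded_clinear_sub:
  fixes f g :: "'a::complex_normed_vector \<Rightarrow> 'a"
  assumes "bounded_clinear f" "bounded_clinear g"
  shows "bounded_clinear (\<lambda>x. f x - g x)"
  using assms unfolding bounded_clinear_def
  by (auto intro: bounded_linear_sub simp: cvec.scale_right_diff_distrib)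

lemma bounded_clinear_funpow:
  "bounded_clinear f \<Longrightarrow> bounded_clinear (f ^^ k)"
proof (induction k)
  case 0
  show ?case
    using bounded_clinear_id by (simp add: id_def)
next
  case (Suc k)
  then show ?case
    using bounded_clinear_compose[of f "f ^^ k"] by (simp add: o_def)
qed

lemma norm_funpow_le:
  fixes P :: "'a::real_normed_vector \<Rightarrow> 'a"
  assumes "\<And>x. norm (P x) \<le> g * norm x" "g \<ge> 0"
  shows "norm ((P ^^ k) x) \<le> g ^ k * norm x"
proof (induction k)
  case (Suc k)
  have "norm ((P ^^ Suc k) x) \<le> g * norm ((P ^^ k) x)"
    by (simp add: assms(1))
  also have "\<dots> \<le> g * (g ^ k * norm x)"
    using Suc assms(2) by (rule mult_left_mono)
  finally show ?case
    by (simp add: mult.assoc)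
qed simp

lemma commute_funpow:
  assumes "\<And>x. V (P x) = P (V x)"
  shows "V ((P ^^ k) x) = (P ^^ k) (V x)"
  by (induction k arbitrary: x) (simp_all add: assms)

text \<open>The Weierstrass test for series of operators: the bounds \<open>c k\<close> force
  absolute convergence at each vector, and \<open>suminf c\<close> bounds the sum.\<close>

lemma
  fixes V :: "nat \<Rightarrow> 'a::complex_banach \<Rightarrow> 'a"
  assumes lin: "\<And>k. bounded_clinear (V k)"
    and bound: "\<And>k x. norm (V k x) \<le> c k * norm x"
    and summable: "summable c"
  shows summable_operators: "summable (\<lambda>k. V k x)"
    and bounded_clinear_suminf: "bounded_clinear (\<lambda>x. \<Sum>k. V k x)"
proof -
  have sm: "summable (\<lambda>k. norm (V k x))" for x
    by (rule summable_comparison_test'[OF summable_mult2[OF summable, of "norm x"]])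
      (use bound in auto)
  show sm': "summable (\<lambda>k. V k x)" for x
    by (rule summable_norm_cancel[OF sm])
  show "bounded_clinear (\<lambda>x. \<Sum>k. V k x)"
  proof (rule bounded_clinearI[where K = "suminf c"])
    fix x y d
    show "(\<Sum>k. V k (x + y)) = (\<Sum>k. V k x) + (\<Sum>k. V k y)"
      by (simp add: suminf_add sm' bounded_clinear_add[OF lin])
    show "(\<Sum>k. V k (d *\<^sub>C x)) = d *\<^sub>C (\<Sum>k. V k x)"
      using bounded_linear.suminf[OF bounded_clinear_bounded_linear[OF bounded_clinear_scaleC_right] sm', of d x]
      by (simp add: bounded_clinear_scaleC[OF lin])
    have "norm (\<Sum>k. V k x) \<le> (\<Sum>k. norm (V k x))"
      by (rule summable_norm[OF sm])
    also have "\<dots> \<le> (\<Sum>k. c k * norm x)"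
      by (intro suminf_le bound sm summable_mult2 summable)
    finally show "norm (\<Sum>k. V k x) \<le> suminf c * norm x"
      by (simp add: suminf_mult2 summable)
  qed
qed

text \<open>By Baire's theorem one of the closed sets \<open>C n\<close> contains a ball. Bounds on
  a ball around \<open>a\<close> become bounds on a ball around 0 by subtracting
  \<open>f a\<close>.\<close>

lemma uniform_boundedness:
  fixes F :: "('a::banach \<Rightarrow> 'b::real_normed_vector) set"
  assumes lin: "\<And>f. f \<in> F \<Longrightarrow> bounded_linear f"
    and bdd: "\<And>x. \<exists>K. \<forall>f\<in>F. norm (f x) \<le> K"
  shows "\<exists>K\<ge>0. \<forall>f\<in>F. \<forall>x. norm (f x) \<le> K * norm x"
proof -
  define C where "C n = {x. \<forall>f\<in>F. norm (f x) \<le> real n}" for n :: nat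
  have closed_C: "closed (C n)" for n
  proof -
    have "C n = (\<Inter>f\<in>F. {x. norm (f x) \<le> real n})"
      by (auto simp: C_def)
    moreover have "closed {x. norm (f x) \<le> real n}" if "f \<in> F" for f
      by (intro closed_Collect_le continuous_on_norm linear_continuous_on lin that continuous_on_const)
    ultimately show ?thesis
      by auto
  qed
  have UN: "(\<Union>n. C n) = UNIV"
  proof -
    have "\<exists>n. x \<in> C n" for x
    proof -
      obtain K where K: "\<forall>f\<in>F. norm (f x) \<le> K"
        using bdd[of x] by (elim exE)
      obtain n where "K \<le> real n"
        using real_arch_simple by blast
      then show ?thesis
        using K unfolding C_def by (auto intro: order_trans)
    qed
    then show ?thesis
      by auto
  qed
  have "\<exists>n. interior (C n) \<noteq> {}"
  proof (rule ccontr)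
    assume neg: "\<not> ?thesis"
    have "euclidean interior_of \<Union>(range C) = {}"
    proof (rule Baire_category_alt)
      show "closedin euclidean S \<and> euclidean interior_of S = {}" if "S \<in> range C" for S
        using that neg closed_C by auto
    qed (simp_all add: completely_metrizable_space_euclidean)
    then show False
      using UN by simp
  qed
  then obtain n a where "a \<in> interior (C n)"
    by blast
  then obtain e where e: "e > 0" "cball a e \<subseteq> C n"
    unfolding mem_interior_cball by blast
  show ?thesis
  proof (intro exI[of _ "2 * real n / e"] conjI ballI allI)
    show "0 \<le> 2 * real n / e"
      using e(1) by simp
    fix f x assume f: "f \<in> F"
    interpret bounded_linear f
      by (rule lin[OF f])
    show "norm (f x) \<le> 2 * real n / e * norm x"
    proof (cases "x = 0")
      case False
      \<comment> \<open>Rescaled to length \<open>e\<close>, so that \<open>a + y\<close> still lies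
        in the closed ball.\<close>
      define y where "y = (e / norm x) *\<^sub>R x"
      have "norm y = e"
        using False e(1) by (simp add: y_def)
      then have "a + y \<in> cball a e" "a \<in> cball a e"
        using e(1) by (auto simp: dist_norm)
      then have "a + y \<in> C n" "a \<in> C n"
        using e(2) by blast+
      then have *: "norm (f (a + y)) \<le> n" "norm (f a) \<le> n"
        using f by (auto simp: C_def)
      have "norm (f y) \<le> norm (f (a + y)) + norm (f a)"
        using norm_triangle_ineq4[of "f (a + y)" "f a"] by (simp add: add)
      with * have "norm (f y) \<le> 2 * real n"
        by simp
      moreover have "norm (f y) = e / norm x * norm (f x)"
        using e(1) by (simp add: y_def scaleR)
      ultimately show ?thesis
        using False e(1) by (simp add: field_simps)
    qed (simp add: zero)
  qed
qed

subsection \<open>Power series in a bounded operator\<close>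

text \<open>The holomorphic functional calculus for functions on a disc about 0 that is larger than
  a norm bound of \<open>P\<close>. Formal series as arguments turn products of functions into
  Cauchy products and avoid contour integrals.\<close>

definition fun_calc :: "complex fps \<Rightarrow> ('a::complex_normed_vector \<Rightarrow> 'a) \<Rightarrow> 'a \<Rightarrow> 'a"
  where "fun_calc F P x = (\<Sum>k. fps_nth F k *\<^sub>C (P ^^ k) x)"

locale bounded_operator =
  fixes P :: "'a::complex_banach \<Rightarrow> 'a" and g :: real
  assumes clin: "bounded_clinear P" and norm_le: "norm (P x) \<le> g * norm x" and g_nonneg: "g \<ge> 0"
begin

lemma summable_coeffs:
  assumes "fps_conv_radius F > g"
  shows "summable (\<lambda>k. cmod (fps_nth F k) * g ^ k)"
  using abs_summable_in_conv_radius[of "complex_of_real g" "fps_nth F"] assms g_nonneg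
  by (simp add: fps_conv_radius_def norm_mult norm_power)

lemma norm_term: "norm (c *\<^sub>C (P ^^ k) x) \<le> (cmod c * g ^ k) * norm x"
  using mult_left_mono[OF norm_funpow_le[of P g k x, OF norm_le g_nonneg], of "cmod c"]
  by (simp add: norm_scaleC mult.assoc)

lemma
  assumes "fps_conv_radius F > g"
  shows summable_fun_calc: "summable (\<lambda>k. fps_nth F k *\<^sub>C (P ^^ k) x)"
    and bounded_clinear_fun_calc: "bounded_clinear (fun_calc F P)"
proof -
  have 1: "bounded_clinear (\<lambda>x. fps_nth F k *\<^sub>C (P ^^ k) x)" for k
    by (intro bounded_clinear_const_scaleC bounded_clinear_funpow clin)
  note a = 1 norm_term summable_coeffs[OF assms]
  show "summable (\<lambda>k. fps_nth F k *\<^sub>C (P ^^ k) x)"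
    by (rule summable_operators[OF a])
  show "bounded_clinear (fun_calc F P)"
    using bounded_clinear_suminf[OF a] by (simp add: fun_calc_def[abs_def])
qed

lemma fun_calc_commute:
  assumes "fps_conv_radius F > g" "bounded_clinear V" "\<And>x. V (P x) = P (V x)"
  shows "V (fun_calc F P x) = fun_calc F P (V x)"
  unfolding fun_calc_def
  using bounded_linear.suminf[OF bounded_clinear_bounded_linear[OF assms(2)]
      summable_fun_calc[OF assms(1)], of x]
  by (simp add: bounded_clinear_scaleC[OF assms(2)] commute_funpow[of V P, OF assms(3)])

lemma fun_calc_diff:
  assumes "fps_conv_radius F > g" "fps_conv_radius H > g"
  shows "fun_calc (F - H) P x = fun_calc F P x - fun_calc H P x"
  unfolding fun_calc_def
  using suminf_diff[OF summable_fun_calc[OF assms(1)] summable_fun_calc[OF assms(2)], of x]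
  by (simp add: cvec.scale_left_diff_distrib)

lemma fun_calc_const: "fun_calc (fps_const c) P x = c *\<^sub>C x"
proof -
  have "(\<Sum>k. fps_nth (fps_const c) k *\<^sub>C (P ^^ k) x) =
      (\<Sum>k\<in>{0}. fps_nth (fps_const c) k *\<^sub>C (P ^^ k) x)"
    by (rule suminf_finite) auto
  then show ?thesis
    by (simp add: fun_calc_def)
qed

lemma fun_calc_1: "fun_calc 1 P x = x"
  using fun_calc_const[of 1 x] by simp

lemma fun_calc_X: "fun_calc fps_X P x = P x"
proof -
  have "(\<Sum>k. fps_nth fps_X k *\<^sub>C (P ^^ k) x) = (\<Sum>k\<in>{1}. fps_nth fps_X k *\<^sub>C (P ^^ k) x)"
    by (rule suminf_finite) (auto simp: fps_X_def)
  then show ?thesis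
    by (simp add: fun_calc_def)
qed

text \<open>The double series \<open>u\<close> is summed twice: by rows it gives the composition, by
  antidiagonals the Cauchy product. Absolute convergence makes the two sums equal.\<close>

lemma fun_calc_mult:
  assumes F: "fps_conv_radius F > g" and H: "fps_conv_radius H > g"
  shows "fun_calc (F * H) P x = fun_calc F P (fun_calc H P x)"
proof -
  define u where "u = (\<lambda>(i, j). (fps_nth F i * fps_nth H j) *\<^sub>C (P ^^ (i + j)) x)"
  have u_eq: "u (i, j) = fps_nth F i *\<^sub>C (P ^^ i) (fps_nth H j *\<^sub>C (P ^^ j) x)" for i j
    by (simp add: u_def funpow_add bounded_clinear_scaleC[OF bounded_clinear_funpow[OF clin]]
        scaleC_scaleC)
  define a where "a i = cmod (fps_nth F i) * g ^ i" for i
  define b where "b j = cmod (fps_nth H j) * g ^ j * norm x" for j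
  have a0: "a i \<ge> 0" and b0: "b i \<ge> 0" for i
    using g_nonneg by (simp_all add: a_def b_def)
  have norm_u: "norm (u (i, j)) \<le> a i * b j" for i j
    using norm_term[of "fps_nth F i * fps_nth H j" "i + j" x]
    by (simp add: u_def a_def b_def norm_mult power_add mult_ac)
  have sa: "summable a" and sb: "summable b"
    unfolding a_def b_def using summable_coeffs[OF F] summable_coeffs[OF H]
    by (auto intro: summable_mult2)
  have hsum: "(c has_sum suminf c) UNIV" if "summable c" "\<And>i. c i \<ge> 0" for c :: "nat \<Rightarrow> real"
    using that by (intro norm_summable_imp_has_sum summable_sums) auto
  \<comment> \<open>A product of two nonnegative summable families dominates
    \<open>norm (u (i, j))\<close>.\<close>
  have "(\<lambda>(i, j). a i * b j) summable_on Sigma UNIV (\<lambda>_. UNIV)"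
  proof (rule summable_on_SigmaI)
    show "((\<lambda>j. case (i, j) of (i, j) \<Rightarrow> a i * b j) has_sum (a i * suminf b)) UNIV" for i
      using has_sum_cmult_right[OF hsum[OF sb b0]] by simp
    show "(\<lambda>i. a i * suminf b) summable_on UNIV"
      using hsum[OF sa a0] by (intro summable_on_cmult_left) (auto simp: summable_on_def)
  qed (use a0 b0 in auto)
  then have "(\<lambda>p. norm (u p)) summable_on Sigma UNIV (\<lambda>_. UNIV)"
    by (rule Infinite_Sum.abs_summable_on_comparison_test') (use norm_u in auto)
  then obtain S where S: "(u has_sum S) (Sigma UNIV (\<lambda>_. UNIV))"
    using abs_summable_summable summable_on_def by blast
  have rows: "((\<lambda>j. u (i, j)) has_sum (fps_nth F i *\<^sub>C (P ^^ i) (fun_calc H P x))) UNIV" for i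
  proof -
    have lin: "bounded_linear (\<lambda>x. fps_nth F i *\<^sub>C (P ^^ i) x)"
      by (intro bounded_clinear_bounded_linear bounded_clinear_const_scaleC
          bounded_clinear_funpow clin)
    have "summable (\<lambda>j. norm (fps_nth H j *\<^sub>C (P ^^ j) x))"
      by (rule summable_comparison_test'[OF sb]) (use norm_term in \<open>auto simp: b_def\<close>)
    then have "((\<lambda>j. fps_nth H j *\<^sub>C (P ^^ j) x) has_sum fun_calc H P x) UNIV"
      unfolding fun_calc_def
      by (intro norm_summable_imp_has_sum summable_sums summable_fun_calc[OF H])
    from has_sum_bounded_linear[OF lin this] show ?thesis
      by (simp add: u_eq)
  qed
  have "((\<lambda>i. fps_nth F i *\<^sub>C (P ^^ i) (fun_calc H P x)) has_sum S) UNIV"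
    by (rule has_sum_SigmaD[OF S]) (use rows in auto)
  then have S1: "S = fun_calc F P (fun_calc H P x)"
    unfolding fun_calc_def[of F] by (metis has_sum_imp_sums sums_unique)
  \<comment> \<open>The same family, indexed by the antidiagonal \<open>n = i + j\<close> and the
    position \<open>i\<close> on it.\<close>
  have "((\<lambda>(n, i). u (i, n - i)) has_sum S) (Sigma UNIV (\<lambda>n. {..n}))"
    by (rule has_sum_reindex_bij_witness[where i = "\<lambda>(i, j). (i + j, i)" and j = "\<lambda>(n, i). (i, n - i)",
          THEN iffD2, OF _ _ _ _ _ _ S]) auto
  then have "((\<lambda>n. \<Sum>i\<le>n. u (i, n - i)) has_sum S) UNIV"
    by (rule has_sum_SigmaD) (auto intro: has_sum_finite)
  moreover have "(\<Sum>i\<le>n. u (i, n - i)) = fps_nth (F * H) n *\<^sub>C (P ^^ n) x" for n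
    by (simp add: u_def fps_mult_nth atLeast0AtMost cvec.scale_sum_left)
  ultimately have "S = fun_calc (F * H) P x"
    using has_sum_imp_sums sums_unique unfolding fun_calc_def by fastforce
  with S1 show ?thesis
    by simp
qed

end

text \<open>Turns exp(t P) into the scalar exp(l t) when \<open>P\<close> is multiplication by
  \<open>l\<close>.\<close>

lemma fun_calc_scaleC:
  assumes "fps_conv_radius F > cmod c"
  shows "fun_calc F (\<lambda>x. c *\<^sub>C x) (x::'a::complex_banach) = eval_fps F c *\<^sub>C x"
proof -
  have pow: "((\<lambda>x. c *\<^sub>C x) ^^ k) x = c ^ k *\<^sub>C x" for k
    by (induction k) (simp_all add: scaleC_scaleC)
  have lin: "bounded_linear (\<lambda>d. d *\<^sub>C x)"
    by (rule bounded_linear_intro[where K = "norm x"])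
      (simp_all add: scaleC_add_left scaleR_scaleC scaleC_complex_def scaleC_scaleC norm_scaleC)
  show ?thesis
    using bounded_linear.suminf[OF lin summable_fps[OF assms]]
    by (simp add: fun_calc_def pow eval_fps_def scaleC_scaleC)
qed

subsection \<open>Cancelling the zeros of an entire function\<close>

text \<open>The local cofactor near \<open>a\<close> and the quotient away from \<open>a\<close>
  agree where both are defined, so they glue to an entire function. That \<open>g a\<close> is
  nonzero says that the zero is removed with its full order.\<close>

lemma holomorphic_divide_out_zero:
  assumes f: "f holomorphic_on UNIV" and nc: "\<not> f constant_on UNIV" and a: "f a = 0"
  obtains n g where "g holomorphic_on UNIV" "\<And>z. f z = (z - a) ^ n * g z" "g a \<noteq> 0"
proof -
  obtain g r n where gr: "0 < n" "0 < r" "g holomorphic_on ball a r"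
      "\<And>w. w \<in> ball a r \<Longrightarrow> f w = (w - a) ^ n * g w"
      "\<And>w. w \<in> ball a r \<Longrightarrow> g w \<noteq> 0"
    using holomorphic_factor_zero_nonconstant[OF f open_UNIV connected_UNIV UNIV_I a nc] by metis
  define k where "k z = (if z = a then g a else f z / (z - a) ^ n)" for z
  have k_g: "k w = g w" if "w \<in> ball a r" for w
    using gr(4)[OF that] by (auto simp: k_def)
  have "k holomorphic_on ball a r"
    using gr(3) k_g holomorphic_cong by blast
  moreover have "k holomorphic_on - {a}"
  proof -
    have "(\<lambda>z. f z / (z - a) ^ n) holomorphic_on - {a}"
      by (intro holomorphic_intros holomorphic_on_subset[OF f]) auto
    then show ?thesis
      by (rule holomorphic_transform) (auto simp: k_def)
  qed
  ultimately have "k holomorphic_on ball a r \<union> - {a}"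
    by (intro holomorphic_on_Un) auto
  moreover have "ball a r \<union> - {a} = UNIV"
    using gr(2) by auto
  ultimately have "k holomorphic_on UNIV"
    by simp
  moreover have "f z = (z - a) ^ n * k z" for z
    using gr(1) a by (auto simp: k_def)
  moreover have "k a \<noteq> 0"
    using gr(2,5) by (simp add: k_def)
  ultimately show ?thesis
    by (rule that)
qed

text \<open>Induction on the number of distinct zeros in the closed ball, which is finite by
  compactness. Each round strips one zero with its whole multiplicity; once none is left,
  \<open>1 / f\<close> serves as \<open>h\<close>. The point \<open>b\<close> only excludes the zero
  function, and its property passes to the cofactor.\<close>

lemma entire_zeros_cancelled_on_ball:
  assumes "f holomorphic_on UNIV" "f b \<noteq> 0"
  shows "\<exists>as h. (\<forall>a\<in>set as. f a = 0) \<and> h holomorphic_on ball 0 r \<and>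
           (\<forall>z\<in>ball 0 r. f z * h z = prod_list (map (\<lambda>a. z - a) as))"
proof -
  have fin: "finite {z \<in> cball 0 r. f z = 0}" if "f holomorphic_on UNIV" "f b \<noteq> 0" for f :: "complex \<Rightarrow> complex"
  proof (cases "f constant_on UNIV")
    case True
    with that show ?thesis
      by (auto simp: constant_on_def)
  next
    case False
    then show ?thesis
      using holomorphic_compact_finite_zeros[OF that(1), of "cball 0 r"] by auto
  qed
  show ?thesis
    using assms
  proof (induction "card {z \<in> cball 0 r. f z = 0}" arbitrary: f rule: less_induct)
    case less
    show ?case
    proof (cases "{z \<in> cball 0 r. f z = 0} = {}")
      case True
      have "(\<lambda>z. 1 / f z) holomorphic_on ball 0 r"
        using True by (intro holomorphic_intros holomorphic_on_subset[OF less.prems(1)]) auto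
      moreover have "\<forall>z\<in>ball 0 r. f z * (1 / f z) = 1"
        using True by auto
      ultimately show ?thesis
        by (intro exI[of _ "[]"] exI[of _ "\<lambda>z. 1 / f z"]) auto
    next
      case False
      then obtain a where a: "a \<in> cball 0 r" "f a = 0"
        by blast
      then have "\<not> f constant_on UNIV"
        using less.prems(2) unfolding constant_on_def by (metis UNIV_I)
      from holomorphic_divide_out_zero[OF less.prems(1) this a(2)]
      obtain n g where g: "g holomorphic_on UNIV" "\<And>z. f z = (z - a) ^ n * g z" "g a \<noteq> 0"
        by metis
      \<comment> \<open>Zeros of \<open>g\<close> are zeros of \<open>f\<close>, and
        \<open>a\<close> is a zero of \<open>f\<close> alone.\<close>
      have "card {z \<in> cball 0 r. g z = 0} < card {z \<in> cball 0 r. f z = 0}"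
        using a g by (intro psubset_card_mono fin less.prems psubsetI) auto
      moreover have "g b \<noteq> 0"
        using less.prems(2) g(2) by auto
      ultimately obtain as h where h: "\<forall>a\<in>set as. g a = 0" "h holomorphic_on ball 0 r"
          "\<And>z. z \<in> ball 0 r \<Longrightarrow> g z * h z = prod_list (map (\<lambda>a. z - a) as)"
        using less.hyps[OF _ g(1)] by metis
      show ?thesis
      proof (intro exI[of _ "replicate n a @ as"] exI[of _ h] conjI ballI)
        show "f x = 0" if "x \<in> set (replicate n a @ as)" for x
          using that a(2) h(1) g(2) by (auto split: if_splits)
        show "f z * h z = prod_list (map (\<lambda>a. z - a) (replicate n a @ as))"
          if "z \<in> ball 0 r" for z
          using h(3)[OF that] by (simp add: g(2) mult.assoc prod_list_replicate)
      qed (rule h(2))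
    qed
  qed
qed

text \<open>Uniqueness of power series expansions turns the identity of functions near 0 into one of
  formal series, the form that \<open>fun_calc\<close> accepts.\<close>

lemma fps_zeros_cancelled:
  assumes F: "f has_fps_expansion F" and f: "f holomorphic_on UNIV" "f b \<noteq> 0"
  obtains as H where "\<forall>a\<in>set as. f a = 0" "fps_conv_radius H > ereal g"
    "F * H = prod_list (map (\<lambda>a. fps_X - fps_const a) as)"
proof -
  \<comment> \<open>The ball must contain 0 and have radius strictly larger than \<open>g\<close>,
    whatever the sign of \<open>g\<close>.\<close>
  define r where "r = max g 0 + 1"
  obtain as h where h: "\<forall>a\<in>set as. f a = 0" "h holomorphic_on ball 0 r"
      "\<And>z. z \<in> ball 0 r \<Longrightarrow> f z * h z = prod_list (map (\<lambda>a. z - a) as)"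
    using entire_zeros_cancelled_on_ball[OF f, of r] by metis
  define H where "H = fps_expansion h 0"
  have r: "r > 0" "r > g"
    by (auto simp: r_def)
  have "fps_conv_radius H \<ge> ereal r"
    unfolding H_def by (rule conv_radius_fps_expansion) (use h(2) in simp)
  then have rad: "fps_conv_radius H > ereal g"
    using r(2) less_le_trans[of "ereal g" "ereal r"] by simp
  have "h has_fps_expansion H"
    unfolding H_def by (rule has_fps_expansion_fps_expansion[OF open_ball _ h(2)]) (use r in simp)
  then have fh: "(\<lambda>z. f z * h z) has_fps_expansion F * H"
    by (rule has_fps_expansion_mult[OF F])
  have ev: "eventually (\<lambda>z. f z * h z = prod_list (map (\<lambda>a. z - a) as)) (nhds 0)"
  proof (rule eventually_mono)
    show "eventually (\<lambda>z. z \<in> ball 0 r) (nhds (0 :: complex))"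
      using r(1) by (intro eventually_nhds_in_open) auto
  qed (rule h(3))
  have "(\<lambda>z. prod_list (map (\<lambda>a. z - a) bs)) has_fps_expansion
      prod_list (map (\<lambda>a. fps_X - fps_const a) bs)" for bs :: "complex list"
  proof (induction bs)
    case (Cons b bs)
    have "(\<lambda>z. z - b) has_fps_expansion fps_X - fps_const b"
      by (intro fps_expansion_intros)
    from has_fps_expansion_mult[OF this Cons] show ?case
      by simp
  qed simp
  moreover have "(\<lambda>z. prod_list (map (\<lambda>a. z - a) as)) has_fps_expansion F * H"
    using fh has_fps_expansion_cong[OF ev refl] by blast
  ultimately have "F * H = prod_list (map (\<lambda>a. fps_X - fps_const a) as)"
    using fps_expansion_unique_complex by blast
  from that[OF h(1) rad this] show ?thesis .
qed

subsection \<open>Differentiable semigroups\<close>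

text \<open>Replaces \<open>inv_into\<close> by an arbitrary bounded two-sided inverse, which
  injectivity on \<open>D\<close> identifies with it.\<close>

lemma resolvent_setI:
  assumes "bounded_clinear R" "\<And>x. R x \<in> D" "\<And>x. l *\<^sub>C R x - S (R x) = x"
    "\<And>x. x \<in> D \<Longrightarrow> R (l *\<^sub>C x - S x) = x"
  shows "l \<in> resolvent_set D S"
proof -
  let ?f = "\<lambda>x. l *\<^sub>C x - S x"
  have bij: "bij_betw ?f D UNIV"
    by (rule bij_betwI[where g = R]) (use assms in auto)
  moreover have "inv_into D ?f = R"
  proof
    fix x
    show "inv_into D ?f x = R x"
      using assms bij by (intro inv_into_f_eq) (auto simp: bij_betw_def)
  qed
  ultimately show ?thesis
    using assms(1) by (simp add: resolvent_set_def)
qed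

lemma resolvent_setE:
  assumes "l \<in> resolvent_set D S"
  obtains R where "bounded_clinear R" "\<And>x. R x \<in> D" "\<And>x. l *\<^sub>C R x - S (R x) = x"
    "\<And>x. x \<in> D \<Longrightarrow> R (l *\<^sub>C x - S x) = x"
proof (rule that)
  let ?f = "\<lambda>x. l *\<^sub>C x - S x"
  have bij: "bij_betw ?f D UNIV" and lin: "bounded_clinear (inv_into D ?f)"
    using assms by (auto simp: resolvent_set_def)
  show "bounded_clinear (inv_into D ?f)"
    by (rule lin)
  show "inv_into D ?f x \<in> D" for x
    using bij by (auto simp: bij_betw_def intro: inv_into_into)
  show "l *\<^sub>C inv_into D ?f x - S (inv_into D ?f x) = x" for x
    using bij f_inv_into_f[of x ?f D] by (auto simp: bij_betw_def)
  show "inv_into D ?f (l *\<^sub>C x - S x) = x" if "x \<in> D" for x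
    using bij that inv_into_f_f[of ?f D x] by (auto simp: bij_betw_def)
qed

text \<open>For \<open>k > 0\<close> this is the integral of (s - r)^(k-1) / (k-1)! T(r) x over r
  from 0 to s. The recursive form lets all its properties follow by induction on
  \<open>k\<close>.\<close>

primrec iterated_integral :: "(real \<Rightarrow> 'a \<Rightarrow> 'a::complex_banach) \<Rightarrow> nat \<Rightarrow> real \<Rightarrow> 'a \<Rightarrow> 'a"
  where
    "iterated_integral T 0 s x = T s x"
  | "iterated_integral T (Suc k) s x = integral {0..s} (\<lambda>r. iterated_integral T k r x)"

lemma has_integral_power_div_fact:
  fixes s :: real
  assumes "s \<ge> 0"
  shows "((\<lambda>r. r ^ k / fact k) has_integral (s ^ Suc k / fact (Suc k))) {0..s}"
proof -
  have "((\<lambda>r. r ^ k / fact k) has_integral (s ^ Suc k / fact (Suc k) - 0 ^ Suc k / fact (Suc k))) {0..s}"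
  proof (rule fundamental_theorem_of_calculus[OF assms])
    fix r :: real
    have "((\<lambda>r. r ^ Suc k / fact (Suc k)) has_real_derivative (real (Suc k) * r ^ k / fact (Suc k)))
        (at r within {0..s})"
      by (rule DERIV_cdivide) (use DERIV_power[OF DERIV_ident, of "Suc k" r "{0..s}"] in simp)
    moreover have "real (Suc k) * r ^ k / fact (Suc k) = r ^ k / fact k"
      by (simp del: of_nat_Suc)
    ultimately show "((\<lambda>r. r ^ Suc k / fact (Suc k)) has_vector_derivative (r ^ k / fact k))
        (at r within {0..s})"
      by (simp add: has_real_derivative_iff_has_vector_derivative)
  qed
  then show ?thesis
    by simp
qed

section \<open>The generator and the bounded operators commuting with the semigroup\<close>

locale smooth_semigroup =
  fixes T :: "real \<Rightarrow> 'a::complex_banach \<Rightarrow> 'a"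
  assumes diff: "differentiable_semigroup T"
begin

abbreviation "D \<equiv> generator_dom T"
abbreviation "A \<equiv> generator T"

lemma clin_T: "s \<ge> 0 \<Longrightarrow> bounded_clinear (T s)"
  and T_0: "T 0 x = x"
  and T_add: "s \<ge> 0 \<Longrightarrow> r \<ge> 0 \<Longrightarrow> T (s + r) x = T s (T r x)"
  and T_tendsto: "((\<lambda>s. T s x) \<longlongrightarrow> x) (at_right 0)"
  and T_differentiable: "s > 0 \<Longrightarrow> (\<lambda>s. T s x) differentiable (at s)"
  using diff unfolding differentiable_semigroup_def C0_semigroup_def by blast+

text \<open>The bounded commutant of the semigroup. It is an algebra, and by
  \<open>commuting_generator\<close> its members preserve \<open>D\<close> and commute with
  \<open>A\<close> there, so identities between unbounded operators can be multiplied by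
  them.\<close>

definition commuting :: "('a \<Rightarrow> 'a) \<Rightarrow> bool"
  where "commuting V \<longleftrightarrow> bounded_clinear V \<and> (\<forall>s\<ge>0. \<forall>x. V (T s x) = T s (V x))"

lemma commuting_bounded_clinear: "commuting V \<Longrightarrow> bounded_clinear V"
  and commuting_T: "commuting V \<Longrightarrow> s \<ge> 0 \<Longrightarrow> V (T s x) = T s (V x)"
  by (auto simp: commuting_def)

lemma commuting_semigroup: "s \<ge> 0 \<Longrightarrow> commuting (T s)"
  by (simp add: commuting_def clin_T T_add[symmetric] add.commute)

lemma commuting_id: "commuting (\<lambda>x. x)"
  by (simp add: commuting_def bounded_clinear_id)

lemma commuting_scaleC: "commuting V \<Longrightarrow> commuting (\<lambda>x. c *\<^sub>C V x)"
  using clin_T by (simp add: commuting_def bounded_clinear_const_scaleC bounded_clinear_scaleC)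

lemma commuting_compose: "commuting V \<Longrightarrow> commuting W \<Longrightarrow> commuting (\<lambda>x. V (W x))"
  by (simp add: commuting_def bounded_clinear_compose)

lemma commuting_plus: "commuting V \<Longrightarrow> commuting W \<Longrightarrow> commuting (\<lambda>x. V x + W x)"
  using clin_T by (simp add: commuting_def bounded_clinear_plus bounded_clinear_add)

lemma commuting_sub: "commuting V \<Longrightarrow> commuting W \<Longrightarrow> commuting (\<lambda>x. V x - W x)"
  using clin_T by (simp add: commuting_def bounded_clinear_sub bounded_clinear_diff)

text \<open>Differentiability settles positive times; strong continuity enters only at time
  0.\<close>

lemma continuous_T: "continuous_on {0..} (\<lambda>s. T s x)"
  unfolding continuous_on_eq_continuous_within
proof
  fix s :: real assume "s \<in> {0..}"
  show "continuous (at s within {0..}) (\<lambda>s. T s x)"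
  proof (cases "s = 0")
    case True
    then show ?thesis
      using T_tendsto[of x] by (simp add: continuous_within at_within_Ici_at_right T_0)
  next
    case False
    then show ?thesis
      using \<open>s \<in> {0..}\<close> continuous_at_imp_continuous_at_within[OF
          differentiable_imp_continuous_within[OF T_differentiable[of s x]]] by simp
  qed
qed

lemma T_bound:
  obtains M where "M \<ge> 0" "\<And>s x. 0 \<le> s \<Longrightarrow> s \<le> b \<Longrightarrow> norm (T s x) \<le> M * norm x"
proof -
  have "\<exists>M\<ge>0. \<forall>f\<in>T ` {0..b}. \<forall>x. norm (f x) \<le> M * norm x"
  proof (rule uniform_boundedness)
    show "bounded_linear f" if "f \<in> T ` {0..b}" for f
      using that bounded_clinear_bounded_linear[OF clin_T] by force
    show "\<exists>K. \<forall>f\<in>T ` {0..b}. norm (f x) \<le> K" for x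
    proof -
      have "bounded ((\<lambda>s. T s x) ` {0..b})"
        by (intro compact_imp_bounded compact_continuous_image
            continuous_on_subset[OF continuous_T]) auto
      then show ?thesis
        by (auto simp: bounded_iff)
    qed
  qed
  then show ?thesis
    using that by auto
qed

lemma generator_tendsto:
  assumes "x \<in> D"
  shows "((\<lambda>h. (T h x - x) /\<^sub>R h) \<longlongrightarrow> A x) (at_right 0)"
proof -
  from assms obtain y where y: "((\<lambda>h. (T h x - x) /\<^sub>R h) \<longlongrightarrow> y) (at_right 0)"
    by (auto simp: generator_dom_def)
  then show ?thesis
    using tendsto_Lim[OF _ y] by (simp add: generator_def)
qed

lemma generatorI:
  assumes "((\<lambda>h. (T h x - x) /\<^sub>R h) \<longlongrightarrow> y) (at_right 0)"
  shows generator_domI: "x \<in> D" and generator_eqI: "A x = y"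
  using assms tendsto_Lim[OF _ assms] by (auto simp: generator_dom_def generator_def)

lemma
  assumes V: "commuting V" and x: "x \<in> D"
  shows commuting_generator_dom: "V x \<in> D" and commuting_generator: "A (V x) = V (A x)"
proof -
  note lin = commuting_bounded_clinear[OF V]
  have "((\<lambda>h. V ((T h x - x) /\<^sub>R h)) \<longlongrightarrow> V (A x)) (at_right 0)"
    by (rule bounded_clinear_tendsto[OF lin generator_tendsto[OF x]])
  moreover have "eventually (\<lambda>h. V ((T h x - x) /\<^sub>R h) = (T h (V x) - V x) /\<^sub>R h) (at_right 0)"
    using eventually_at_right_less[of 0]
    by eventually_elim
      (simp add: scaleR_scaleC bounded_clinear_simps[OF lin] commuting_T[OF V] cvec.scale_right_diff_distrib)
  ultimately have "((\<lambda>h. (T h (V x) - V x) /\<^sub>R h) \<longlongrightarrow> V (A x)) (at_right 0)"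
    by (rule Lim_transform_eventually)
  from generatorI[OF this] show "V x \<in> D" "A (V x) = V (A x)"
    by auto
qed

lemma
  assumes x: "x \<in> D" and y: "y \<in> D"
  shows generator_dom_add: "x + y \<in> D" and generator_add: "A (x + y) = A x + A y"
proof -
  have "((\<lambda>h. (T h x - x) /\<^sub>R h + (T h y - y) /\<^sub>R h) \<longlongrightarrow> A x + A y) (at_right 0)"
    by (intro tendsto_add generator_tendsto x y)
  moreover have "eventually (\<lambda>h. (T h x - x) /\<^sub>R h + (T h y - y) /\<^sub>R h =
      (T h (x + y) - (x + y)) /\<^sub>R h) (at_right 0)"
    using eventually_at_right_less[of 0]
    by eventually_elim (simp add: bounded_clinear_add[OF clin_T] algebra_simps)
  ultimately have "((\<lambda>h. (T h (x + y) - (x + y)) /\<^sub>R h) \<longlongrightarrow> A x + A y) (at_right 0)"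
    by (rule Lim_transform_eventually)
  from generatorI[OF this] show "x + y \<in> D" "A (x + y) = A x + A y"
    by auto
qed

lemma
  assumes "x \<in> D"
  shows generator_dom_scaleC: "c *\<^sub>C x \<in> D" and generator_scaleC: "A (c *\<^sub>C x) = c *\<^sub>C A x"
  by (rule commuting_generator_dom[OF commuting_scaleC[OF commuting_id] assms]
      commuting_generator[OF commuting_scaleC[OF commuting_id] assms])+

text \<open>By the semigroup law the right difference quotient of the orbit at \<open>s\<close> is
  the generator quotient at the vector \<open>T s x\<close>.\<close>

lemma
  assumes s: "s > 0"
  shows T_in_generator_dom: "T s x \<in> D"
    and T_has_derivative: "((\<lambda>s. T s x) has_vector_derivative A (T s x)) (at s)"
proof -
  obtain d where d: "((\<lambda>s. T s x) has_vector_derivative d) (at s)"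
    using T_differentiable[OF s, of x] vector_derivative_works by blast
  then have "((\<lambda>h. norm (T (s + h) x - T s x - h *\<^sub>R d) / norm h) \<longlongrightarrow> 0) (at 0)"
    by (simp add: has_vector_derivative_def has_derivative_at)
  then have "((\<lambda>h. norm (T (s + h) x - T s x - h *\<^sub>R d) / norm h) \<longlongrightarrow> 0) (at_right 0)"
    by (rule tendsto_mono[OF at_le, rotated]) auto
  moreover have "eventually (\<lambda>h. norm (T (s + h) x - T s x - h *\<^sub>R d) / norm h =
      norm ((T (s + h) x - T s x) /\<^sub>R h - d)) (at_right 0)"
    using eventually_at_right_less[of 0]
  proof eventually_elim
    case (elim h)
    then have "(T (s + h) x - T s x) /\<^sub>R h - d = (T (s + h) x - T s x - h *\<^sub>R d) /\<^sub>R h"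
      by (simp add: scaleR_diff_right)
    with elim show ?case
      by (simp add: divide_inverse mult.commute)
  qed
  ultimately have "((\<lambda>h. norm ((T (s + h) x - T s x) /\<^sub>R h - d)) \<longlongrightarrow> 0) (at_right 0)"
    by (rule Lim_transform_eventually)
  then have "((\<lambda>h. (T (s + h) x - T s x) /\<^sub>R h) \<longlongrightarrow> d) (at_right 0)"
    using Lim_null tendsto_norm_zero_iff by blast
  moreover have "eventually (\<lambda>h. (T (s + h) x - T s x) /\<^sub>R h = (T h (T s x) - T s x) /\<^sub>R h) (at_right 0)"
    using eventually_at_right_less[of 0]
    by eventually_elim (use s T_add in \<open>simp add: add.commute\<close>)
  ultimately have "((\<lambda>h. (T h (T s x) - T s x) /\<^sub>R h) \<longlongrightarrow> d) (at_right 0)"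
    by (rule Lim_transform_eventually)
  from generatorI[OF this] d show "T s x \<in> D"
      "((\<lambda>s. T s x) has_vector_derivative A (T s x)) (at s)"
    by auto
qed

text \<open>\<open>A T(s)\<close> is the pointwise limit of the bounded difference quotients
  \<open>U n\<close>. Convergent sequences are bounded, so uniform boundedness yields one bound
  \<open>K\<close> that survives the limit.\<close>

lemma commuting_generator_T:
  assumes s: "s > 0"
  shows "commuting (\<lambda>x. A (T s x))"
proof -
  define U where "U n x = (T (inverse (Suc n)) (T s x) - T s x) /\<^sub>R inverse (Suc n)"
    for n :: nat and x
  have lin_U: "bounded_clinear (U n)" for n
    unfolding U_def scaleR_scaleC using s
    by (intro bounded_clinear_const_scaleC bounded_clinear_sub clin_T bounded_clinear_compose[OF clin_T]) auto
  have "filterlim (\<lambda>n. inverse (real (Suc n))) (at_right 0) sequentially"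
    unfolding filterlim_at using LIMSEQ_inverse_real_of_nat by auto
  from filterlim_compose[OF generator_tendsto[OF T_in_generator_dom[OF s]] this]
  have lim: "(\<lambda>n. U n x) \<longlonglongrightarrow> A (T s x)" for x
    unfolding U_def .
  have "\<exists>K\<ge>0. \<forall>f\<in>range U. \<forall>x. norm (f x) \<le> K * norm x"
  proof (rule uniform_boundedness)
    show "bounded_linear f" if "f \<in> range U" for f
      using that lin_U bounded_clinear_bounded_linear by auto
    show "\<exists>K. \<forall>f\<in>range U. norm (f x) \<le> K" for x
      using convergent_imp_Bseq[OF convergentI[OF lim[of x]]] by (auto simp: Bseq_def)
  qed
  then obtain K where K: "\<And>n x. norm (U n x) \<le> K * norm x"
    by auto
  have "bounded_clinear (\<lambda>x. A (T s x))"
  proof (rule bounded_clinearI)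
    show "norm (A (T s x)) \<le> K * norm x" for x
      by (rule LIMSEQ_le_const2[OF tendsto_norm[OF lim]]) (use K in auto)
  qed (use s in \<open>simp_all add: bounded_clinear_simps[OF clin_T] generator_add generator_scaleC
        T_in_generator_dom\<close>)
  moreover have "A (T s (T r x)) = T r (A (T s x))" if "r \<ge> 0" for r x
    using commuting_generator[OF commuting_semigroup[OF that] T_in_generator_dom[OF s]]
      commuting_T[OF commuting_semigroup[of s] that] s by simp
  ultimately show ?thesis
    by (simp add: commuting_def)
qed

text \<open>The fundamental theorem is used in its interior form because
  \<open>T_has_derivative\<close> covers positive times only.\<close>

lemma T_minus_id_eq_integral:
  assumes x: "x \<in> D" and s: "s \<ge> 0"
  shows "integral {0..s} (\<lambda>r. T r (A x)) = T s x - x"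
proof -
  have "((\<lambda>r. T r (A x)) has_integral (T s x - T 0 x)) {0..s}"
  proof (rule fundamental_theorem_of_calculus_interior[OF s])
    show "continuous_on {0..s} (\<lambda>r. T r x)"
      by (rule continuous_on_subset[OF continuous_T]) auto
    show "((\<lambda>r. T r x) has_vector_derivative T r (A x)) (at r)" if "r \<in> {0<..<s}" for r
      using that T_has_derivative[of r x] commuting_generator[OF commuting_semigroup x, of r] by simp
  qed
  then show ?thesis
    using T_0 by (simp add: integral_unique)
qed

text \<open>The difference quotients of \<open>x n\<close> are averages of T(r) A x_n over small r,
  hence close to \<open>y\<close> with an error that is uniform enough to let n tend to infinity
  before \<open>h\<close> tends to 0.\<close>

lemma generator_closed:
  assumes xD: "\<And>n. x n \<in> D" and x: "x \<longlonglongrightarrow> a" and Ax: "(\<lambda>n. A (x n)) \<longlonglongrightarrow> y"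
  shows generator_dom_closed: "a \<in> D" and generator_limit: "A a = y"
proof -
  have "((\<lambda>h. (T h a - a) /\<^sub>R h) \<longlongrightarrow> y) (at_right 0)"
  proof (rule tendstoI)
    fix e :: real assume e: "e > 0"
    obtain M where M: "M \<ge> 0" "\<And>s x. 0 \<le> s \<Longrightarrow> s \<le> 1 \<Longrightarrow> norm (T s x) \<le> M * norm x"
      using T_bound[of 1] by metis
    have "eventually (\<lambda>s. dist (T s y) y < e / 2) (at_right 0)"
      using tendstoD[OF T_tendsto[of y], of "e / 2"] e by simp
    then obtain d where d: "d > 0" "\<And>s. 0 < s \<Longrightarrow> s < d \<Longrightarrow> dist (T s y) y < e / 2"
      by (auto simp: eventually_at_right_field)
    have "dist ((T h a - a) /\<^sub>R h) y < e" if h: "0 < h" "h < min d 1" for h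
    proof -
      \<comment> \<open>The integrand splits into \<open>T r (A (x n) - y)\<close>, which is small
        for large \<open>n\<close>, and \<open>T r y - y\<close>, which the choice of
        \<open>d\<close> keeps below \<open>e / 2\<close>.\<close>
      have *: "norm (T h (x n) - x n - h *\<^sub>R y) \<le> (M * norm (A (x n) - y) + e / 2) * h" for n
      proof -
        have cont: "continuous_on {0..h} (\<lambda>r. T r z)" for z
          by (rule continuous_on_subset[OF continuous_T]) auto
        have "norm (T r (A (x n)) - y) \<le> M * norm (A (x n) - y) + e / 2" if "r \<in> {0..h}" for r
        proof -
          have "norm (T r (A (x n)) - y) \<le> norm (T r (A (x n) - y)) + norm (T r y - y)"
            using that norm_triangle_ineq[of "T r (A (x n) - y)" "T r y - y"]
            by (simp add: bounded_clinear_diff[OF clin_T])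
          moreover have "norm (T r y - y) \<le> e / 2"
            using that h d(2)[of r] e by (cases "r = 0") (auto simp: T_0 dist_norm)
          ultimately show ?thesis
            using M(2)[of r "A (x n) - y"] that h by auto
        qed
        then have "norm (integral {0..h} (\<lambda>r. T r (A (x n)) - y)) \<le>
            (M * norm (A (x n) - y) + e / 2) * (h - 0)"
          using h by (intro integral_bound continuous_intros cont) auto
        moreover have "integral {0..h} (\<lambda>r. T r (A (x n)) - y) = T h (x n) - x n - h *\<^sub>R y"
          using h T_minus_id_eq_integral[OF xD]
          by (subst integral_diff) (auto intro!: integrable_continuous_interval cont)
        ultimately show ?thesis
          by simp
      qed
      have "(\<lambda>n. norm (T h (x n) - x n - h *\<^sub>R y)) \<longlonglongrightarrow> norm (T h a - a - h *\<^sub>R y)"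
        using h by (intro tendsto_intros bounded_clinear_tendsto[OF clin_T] x) auto
      moreover have "(\<lambda>n. (M * norm (A (x n) - y) + e / 2) * h) \<longlonglongrightarrow> (M * norm (y - y) + e / 2) * h"
        by (intro tendsto_intros Ax)
      ultimately have "norm (T h a - a - h *\<^sub>R y) \<le> (M * norm (y - y) + e / 2) * h"
        by (rule LIMSEQ_le) (use * in auto)
      moreover have "(T h a - a) /\<^sub>R h - y = (T h a - a - h *\<^sub>R y) /\<^sub>R h"
        using h by (simp add: scaleR_diff_right)
      ultimately have "dist ((T h a - a) /\<^sub>R h) y \<le> e / 2"
        using h by (simp add: dist_norm divide_simps)
      then show ?thesis
        using e by simp
    qed
    then show "eventually (\<lambda>h. dist ((T h a - a) /\<^sub>R h) y < e) (at_right 0)"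
      unfolding eventually_at_right_field using d(1) by (intro exI[of _ "min d 1"]) auto
  qed
  from generatorI[OF this] show "a \<in> D" "A a = y"
    by auto
qed

section \<open>Iterated integrals of the orbits and variation of constants\<close>

abbreviation "I \<equiv> iterated_integral T"

lemma continuous_I: "continuous_on {0..b} (\<lambda>s. I k s x)"
proof (induction k)
  case 0
  show ?case
    using continuous_on_subset[OF continuous_T] by auto
next
  case (Suc k)
  then show ?case
    by (auto intro!: indefinite_integral_continuous_1 integrable_continuous_interval)
qed

lemma I_integrable: "(\<lambda>s. I k s x) integrable_on {0..b}"
  by (rule integrable_continuous_interval[OF continuous_I])

lemma commuting_I:
  assumes "commuting V" "s \<ge> 0"
  shows "V (I k s x) = I k s (V x)"
  using assms(2)
proof (induction k arbitrary: s)
  case 0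
  then show ?case
    using commuting_T[OF assms(1)] by simp
next
  case (Suc k)
  have "V (I (Suc k) s x) = integral {0..s} (\<lambda>r. V (I k r x))"
    using integral_linear[OF I_integrable
        bounded_clinear_bounded_linear[OF commuting_bounded_clinear[OF assms(1)]], of s k x]
    by (simp add: o_def)
  also have "\<dots> = I (Suc k) s (V x)"
    using Suc.IH by (auto intro!: integral_cong)
  finally show ?case .
qed

lemma I_add: "s \<ge> 0 \<Longrightarrow> I k s (x + y) = I k s x + I k s y"
proof (induction k arbitrary: s)
  case 0
  then show ?case
    by (simp add: bounded_clinear_add[OF clin_T])
next
  case (Suc k)
  have "I (Suc k) s (x + y) = integral {0..s} (\<lambda>r. I k r x + I k r y)"
    using Suc.IH by (auto intro!: integral_cong)
  also have "\<dots> = I (Suc k) s x + I (Suc k) s y"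
    by (simp add: integral_add I_integrable)
  finally show ?case .
qed

lemma norm_I_le:
  assumes M: "\<And>s x. 0 \<le> s \<Longrightarrow> s \<le> b \<Longrightarrow> norm (T s x) \<le> M * norm x" and s: "0 \<le> s" "s \<le> b"
  shows "norm (I k s x) \<le> (s ^ k / fact k) * (M * norm x)"
  using s
proof (induction k arbitrary: s)
  case 0
  then show ?case
    using M[of s x] by simp
next
  case (Suc k)
  have hi: "((\<lambda>r. (r ^ k / fact k) * (M * norm x)) has_integral
      (s ^ Suc k / fact (Suc k)) * (M * norm x)) {0..s}"
    by (rule has_integral_mult_left[OF has_integral_power_div_fact[OF Suc.prems(1)]])
  have "norm (I (Suc k) s x) \<le> integral {0..s} (\<lambda>r. (r ^ k / fact k) * (M * norm x))"
    unfolding iterated_integral.simps using hi Suc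
    by (intro integral_norm_bound_integral I_integrable) auto
  then show ?case
    using hi by (simp only: integral_unique)
qed

lemma bounded_clinear_I:
  assumes "s \<ge> 0"
  shows "bounded_clinear (I k s)"
proof -
  obtain M where M: "M \<ge> 0" "\<And>r x. 0 \<le> r \<Longrightarrow> r \<le> s \<Longrightarrow> norm (T r x) \<le> M * norm x"
    using T_bound[of s] by metis
  from norm_I_le[OF M(2) assms order_refl] show ?thesis
    using commuting_I[OF commuting_scaleC[OF commuting_id] assms] I_add[OF assms]
    by (intro bounded_clinearI[where K = "(s ^ k / fact k) * M"]) (auto simp: mult.assoc)
qed

text \<open>Repeated integration of T(s) x - x. The subtracted terms are the coefficients of the
  exponential series, which is how exp(t P) arises in \<open>variation_of_constants\<close>.\<close>

lemma I_generator:
  assumes x: "x \<in> D" and "s \<ge> 0"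
  shows "I (Suc k) s (A x) = I k s x - (s ^ k / fact k) *\<^sub>R x"
  using assms(2)
proof (induction k arbitrary: s)
  case 0
  then show ?case
    using T_minus_id_eq_integral[OF x] by simp
next
  case (Suc k)
  have hi: "((\<lambda>r. (r ^ k / fact k) *\<^sub>R x) has_integral (s ^ Suc k / fact (Suc k)) *\<^sub>R x) {0..s}"
    by (rule has_integral_scaleR_left[OF has_integral_power_div_fact[OF Suc.prems]])
  have "I (Suc (Suc k)) s (A x) = integral {0..s} (\<lambda>r. I (Suc k) r (A x))"
    by simp
  also have "\<dots> = integral {0..s} (\<lambda>r. I k r x - (r ^ k / fact k) *\<^sub>R x)"
    by (rule integral_cong) (use Suc.IH in auto)
  also have "\<dots> = I (Suc k) s x - (s ^ Suc k / fact (Suc k)) *\<^sub>R x"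
    using hi by (subst integral_diff) (auto simp: I_integrable integral_unique has_integral_integrable)
  finally show ?case .
qed

declare iterated_integral.simps(2)[simp del]

text \<open>\<open>J x\<close> is the Duhamel integral of exp((t - r) P) T(r) x over r from 0 to
  \<open>t\<close>, expanded in powers of \<open>P\<close>. The clause on \<open>V\<close> says that
  \<open>J\<close> inherits commutation from the semigroup and \<open>P\<close>.\<close>

lemma variation_of_constants:
  assumes P: "commuting P" and t: "t \<ge> 0"
  shows "\<exists>J. commuting J \<and>
           (\<forall>V. commuting V \<longrightarrow> (\<forall>x. V (P x) = P (V x)) \<longrightarrow> (\<forall>x. V (J x) = J (V x))) \<and>
           (\<forall>x\<in>D. J (A x - P x) = T t x - fun_calc (fps_exp (complex_of_real t)) P x)"
proof -
  note linP = commuting_bounded_clinear[OF P]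
  obtain g where g: "g > 0" "\<And>x. norm (P x) \<le> g * norm x"
    using bounded_clinear_bound[OF linP] by metis
  interpret P: bounded_operator P g
    by unfold_locales (use g linP in auto)
  obtain M where M: "M \<ge> 0" "\<And>s x. 0 \<le> s \<Longrightarrow> s \<le> t \<Longrightarrow> norm (T s x) \<le> M * norm x"
    using T_bound[of t] by metis
  \<comment> \<open>The index \<open>Suc k\<close> is right: integrating (t - r)^k / k! against the
    orbit is a (k+1)-fold iterated integral.\<close>
  define V where "V k x = (P ^^ k) (I (Suc k) t x)" for k x
  have linV: "bounded_clinear (V k)" for k
    unfolding V_def by (intro bounded_clinear_compose[OF bounded_clinear_funpow[OF linP]]
        bounded_clinear_I t)
  have boundV: "norm (V k x) \<le> (g ^ k * (t ^ Suc k / fact (Suc k) * M)) * norm x" for k x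
  proof -
    have "norm (V k x) \<le> g ^ k * norm (I (Suc k) t x)"
      unfolding V_def using g by (intro norm_funpow_le) auto
    also have "\<dots> \<le> g ^ k * ((t ^ Suc k / fact (Suc k)) * (M * norm x))"
      using g by (intro mult_left_mono norm_I_le[OF M(2) t order_refl]) auto
    finally show ?thesis
      by (simp add: mult_ac)
  qed
  have summable: "summable (\<lambda>k. g ^ k * (t ^ Suc k / fact (Suc k) * M))"
  proof -
    have "summable (\<lambda>k. (g * t) ^ Suc k / fact (Suc k))"
      using summable_exp[of "g * t"]
      by (subst summable_Suc_iff) (simp add: divide_inverse mult.commute)
    from summable_mult[OF this, of "M / g"] show ?thesis
      using g(1) by (simp add: power_mult_distrib field_simps)
  qed
  define J where "J x = (\<Sum>k. V k x)" for x
  have sumV: "summable (\<lambda>k. V k x)" for x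
    by (rule summable_operators[OF linV boundV summable])
  have linJ: "bounded_clinear J"
    unfolding J_def[abs_def] by (rule bounded_clinear_suminf[OF linV boundV summable])
  have comm: "W (J x) = J (W x)" if W: "commuting W" "\<And>x. W (P x) = P (W x)" for W x
  proof -
    have "W (V k x) = V k (W x)" for k
      unfolding V_def using commuting_I[OF W(1) t] commute_funpow[of W P, OF W(2)] by simp
    then show ?thesis
      unfolding J_def
      using bounded_linear.suminf[OF bounded_clinear_bounded_linear[OF
            commuting_bounded_clinear[OF W(1)]] sumV, of x]
      by simp
  qed
  show ?thesis
  proof (intro exI[of _ J] conjI ballI)
    show "\<forall>V. commuting V \<longrightarrow> (\<forall>x. V (P x) = P (V x)) \<longrightarrow> (\<forall>x. V (J x) = J (V x))"
      using comm by blast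
    show "commuting J"
      using linJ comm commuting_semigroup commuting_T[OF P] by (simp add: commuting_def)
    fix x assume x: "x \<in> D"
    have rad: "fps_conv_radius (fps_exp (complex_of_real t)) > g"
      by simp
    \<comment> \<open>Applied to \<open>A x\<close>, the k-th term of \<open>J\<close> is
      \<open>W k\<close> minus an exponential term; applied to \<open>P x\<close>, it is
      \<open>W (Suc k)\<close>. The difference telescopes to \<open>W 0 = T t x\<close> minus the
      exponential.\<close>
    define W where "W k = (P ^^ k) (I k t x)" for k
    have WSuc: "W (Suc k) = V k (P x)" for k
      unfolding W_def V_def by (simp add: commuting_I[OF P t, symmetric] funpow_swap1)
    have VA: "V k (A x) = W k - fps_nth (fps_exp (complex_of_real t)) k *\<^sub>C (P ^^ k) x" for k
      unfolding V_def W_def I_generator[OF x t]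
      by (simp add: scaleR_scaleC bounded_clinear_simps[OF bounded_clinear_funpow[OF linP]])
    have sumW: "summable W"
      using sumV[of "P x"] by (subst summable_Suc_iff[symmetric]) (simp add: WSuc)
    have "J (A x) = suminf W - fun_calc (fps_exp (complex_of_real t)) P x"
      unfolding J_def fun_calc_def VA by (rule suminf_diff[symmetric, OF sumW P.summable_fun_calc[OF rad]])
    moreover have "J (P x) = suminf W - W 0"
      unfolding J_def using suminf_split_head[OF sumW] by (simp add: WSuc)
    ultimately show "J (A x - P x) = T t x - fun_calc (fps_exp (complex_of_real t)) P x"
      by (simp add: bounded_clinear_diff[OF linJ] W_def)
  qed
qed

text \<open>Together with \<open>T_in_generator_dom\<close> this shows that \<open>D\<close> is
  dense.\<close>

lemma T_approx: "(\<lambda>n. T (inverse (real (Suc n))) x) \<longlonglongrightarrow> x"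
proof -
  have "filterlim (\<lambda>n. inverse (real (Suc n))) (at_right 0) sequentially"
    unfolding filterlim_at using LIMSEQ_inverse_real_of_nat by auto
  from filterlim_compose[OF T_tendsto this] show ?thesis .
qed

text \<open>Half of the time is spent on smoothing: A T(s) = T(s/2) A T(s/2), whose range lies in
  \<open>D\<close>. Applying \<open>A\<close> again gives the square of the bounded operator A
  T(s/2).\<close>

lemma generator_T_in_generator_dom:
  assumes s: "s > 0"
  shows "A (T s x) \<in> D" and "A (A (T s x)) = A (T (s / 2) (A (T (s / 2) x)))"
proof -
  have s2: "s / 2 > 0" "s / 2 \<ge> 0"
    using s by auto
  have "A (T s x) = A (T (s / 2) (T (s / 2) x))"
    using T_add[OF s2(2) s2(2), of x] by simp
  also have "\<dots> = T (s / 2) (A (T (s / 2) x))"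
    by (rule commuting_generator[OF commuting_semigroup[OF s2(2)] T_in_generator_dom[OF s2(1)]])
  finally have *: "A (T s x) = T (s / 2) (A (T (s / 2) x))" .
  show "A (T s x) \<in> D" "A (A (T s x)) = A (T (s / 2) (A (T (s / 2) x)))"
    unfolding * using T_in_generator_dom[OF s2(1)] by simp_all
qed

lemma commuting_with_generator_T:
  assumes "commuting V" "s > 0"
  shows "V (A (T s x)) = A (T s (V x))"
  using commuting_generator[OF assms(1) T_in_generator_dom[OF assms(2)]]
    commuting_T[OF assms(1), of s] assms(2) by simp

lemma commuting_resolvent:
  assumes R: "bounded_clinear R" "\<And>x. R x \<in> D" "\<And>x. l *\<^sub>C R x - A (R x) = x"
    "\<And>x. x \<in> D \<Longrightarrow> R (l *\<^sub>C x - A x) = x"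
  shows "commuting R"
  unfolding commuting_def
proof (intro conjI R(1) allI impI)
  fix s :: real and x assume "s \<ge> 0"
  note Ts = commuting_semigroup[OF this]
  have "T s x = T s (l *\<^sub>C R x - A (R x))"
    by (simp add: R(3))
  also have "\<dots> = l *\<^sub>C T s (R x) - A (T s (R x))"
    using commuting_generator[OF Ts R(2)]
    by (simp add: bounded_clinear_simps[OF commuting_bounded_clinear[OF Ts]])
  finally show "R (T s x) = T s (R x)"
    using R(4)[OF commuting_generator_dom[OF Ts R(2)]] by simp
qed

text \<open>The vectors need not be normalised: along indices where \<open>norm (w n)\<close> is at
  least \<open>e\<close>, normalising enlarges the residual by a factor of at most
  \<open>inverse e\<close>.\<close>

lemma approx_point_spectrumI:
  assumes w: "\<And>n. w n \<in> D" "\<not> w \<longlonglongrightarrow> 0" "(\<lambda>n. a *\<^sub>C w n - A (w n)) \<longlonglongrightarrow> 0"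
  shows "a \<in> approx_point_spectrum D A"
proof -
  obtain e where e: "e > 0" "\<And>N. \<exists>n\<ge>N. norm (w n) \<ge> e"
    using w(2) unfolding LIMSEQ_def by (auto simp: not_less)
  then obtain r where r: "\<And>N. r N \<ge> N" "\<And>N. norm (w (r N)) \<ge> e"
    by metis
  have "filterlim r at_top sequentially"
    by (rule filterlim_at_top_mono[OF filterlim_ident]) (use r in auto)
  from filterlim_compose[OF w(3) this]
  have lim: "(\<lambda>n. a *\<^sub>C w (r n) - A (w (r n))) \<longlonglongrightarrow> 0" .
  define c where "c n = complex_of_real (inverse (norm (w (r n))))" for n
  define x where "x n = c n *\<^sub>C w (r n)" for n
  have pos: "norm (w (r n)) > 0" for n
    using e(1) r(2)[of n] by linarith
  have "norm (x n) = 1" "x n \<in> D" for n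
    using pos[of n] generator_dom_scaleC[OF w(1)] by (auto simp: x_def c_def norm_scaleC norm_inverse)
  moreover have "(\<lambda>n. a *\<^sub>C x n - A (x n)) \<longlonglongrightarrow> 0"
  proof (rule Lim_null_comparison)
    have "norm (a *\<^sub>C x n - A (x n)) \<le> inverse e * norm (a *\<^sub>C w (r n) - A (w (r n)))" for n
    proof -
      have "a *\<^sub>C x n - A (x n) = c n *\<^sub>C (a *\<^sub>C w (r n) - A (w (r n)))"
        unfolding x_def generator_scaleC[OF w(1)]
        by (simp add: cvec.scale_right_diff_distrib scaleC_scaleC mult.commute)
      then show ?thesis
        using e(1) r(2)[of n] pos[of n]
        by (auto simp: norm_scaleC c_def norm_inverse intro!: mult_right_mono le_imp_inverse_le)
    qed
    then show "eventually (\<lambda>n. norm (a *\<^sub>C x n - A (x n)) \<le>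
        inverse e * norm (a *\<^sub>C w (r n) - A (w (r n)))) sequentially"
      by simp
    show "(\<lambda>n. inverse e * norm (a *\<^sub>C w (r n) - A (w (r n)))) \<longlonglongrightarrow> 0"
      using tendsto_mult_right_zero[OF tendsto_norm_zero[OF lim]] .
  qed
  ultimately show ?thesis
    unfolding approx_point_spectrum_def by blast
qed

section \<open>From the spectra of \<open>A\<close> to those of A T(t)\<close>

text \<open>With \<open>P = l\<close>, variation of constants reads J (l - A) = exp(l t) - T(t).
  Multiplying by \<open>l\<close> and adding T(t) (l - A) gives the factor C = l J + T(t).\<close>

lemma scalar_factorisation:
  assumes t: "t > 0"
  obtains C where "commuting C" "\<And>V x. commuting V \<Longrightarrow> V (C x) = C (V x)"
    "\<And>x. x \<in> D \<Longrightarrow> C (l *\<^sub>C x - A x) = (l * exp (l * complex_of_real t)) *\<^sub>C x - A (T t x)"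
proof -
  have t0: "t \<ge> 0"
    using t by simp
  obtain J where J: "commuting J"
      "\<forall>V. commuting V \<longrightarrow> (\<forall>x. V (l *\<^sub>C x) = l *\<^sub>C V x) \<longrightarrow> (\<forall>x. V (J x) = J (V x))"
      "\<forall>x\<in>D. J (A x - l *\<^sub>C x) =
          T t x - fun_calc (fps_exp (complex_of_real t)) (\<lambda>x. l *\<^sub>C x) x"
    using variation_of_constants[OF commuting_scaleC[OF commuting_id] t0, of l] by blast
  have J_comm: "V (J x) = J (V x)" if "commuting V" for V x
    using J(2) that bounded_clinear_scaleC[OF commuting_bounded_clinear[OF that]] by blast
  define C where "C x = l *\<^sub>C J x + T t x" for x
  note Tt = commuting_semigroup[OF t0]
  show ?thesis
  proof (rule that)
    show "commuting C"
      unfolding C_def[abs_def] by (intro commuting_plus commuting_scaleC J(1) Tt)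
    show "V (C x) = C (V x)" if V: "commuting V" for V x
      unfolding C_def
      by (simp add: bounded_clinear_simps[OF commuting_bounded_clinear[OF V]] commuting_T[OF V t0]
          J_comm[OF V])
    fix x assume x: "x \<in> D"
    have E: "fun_calc (fps_exp (complex_of_real t)) (\<lambda>x. l *\<^sub>C x) x = exp (l * complex_of_real t) *\<^sub>C x"
      by (subst fun_calc_scaleC) (simp_all add: eval_fps_exp mult.commute)
    have "J (l *\<^sub>C x - A x) = - J (A x - l *\<^sub>C x)"
      using bounded_clinear_minus[OF commuting_bounded_clinear[OF J(1)], of "A x - l *\<^sub>C x"] by simp
    also have "\<dots> = exp (l * complex_of_real t) *\<^sub>C x - T t x"
      using J(3) x by (simp add: E)
    finally have "J (l *\<^sub>C x - A x) = exp (l * complex_of_real t) *\<^sub>C x - T t x" .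
    then show "C (l *\<^sub>C x - A x) = (l * exp (l * complex_of_real t)) *\<^sub>C x - A (T t x)"
      unfolding C_def
      by (simp add: bounded_clinear_simps[OF commuting_bounded_clinear[OF Tt]]
          commuting_generator[OF Tt x] cvec.scale_right_diff_distrib scaleC_scaleC)
  qed
qed

text \<open>If \<open>R\<close> inverts m - A T(t), then \<open>C R\<close> inverts l - A. That
  \<open>C\<close> and \<open>R\<close> commute makes it a left inverse; closedness of
  \<open>A\<close> and density of \<open>D\<close> make it a right inverse.\<close>

lemma resolvent_set_generator:
  assumes t: "t > 0"
    and m: "l * exp (l * complex_of_real t) \<in> resolvent_set UNIV (\<lambda>x. A (T t x))"
  shows "l \<in> resolvent_set D A"
proof -
  define m where "m = l * exp (l * complex_of_real t)"
  obtain C where C: "commuting C" "\<And>V x. commuting V \<Longrightarrow> V (C x) = C (V x)"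
      "\<And>x. x \<in> D \<Longrightarrow> C (l *\<^sub>C x - A x) = m *\<^sub>C x - A (T t x)"
    unfolding m_def using scalar_factorisation[OF t, of l] by metis
  obtain R where R: "bounded_clinear R" "\<And>x. m *\<^sub>C R x - A (T t (R x)) = x"
      "\<And>x. R (m *\<^sub>C x - A (T t x)) = x"
    using resolvent_setE[OF m] unfolding m_def by (metis UNIV_I)
  have comm_R: "commuting R"
    unfolding commuting_def
  proof (intro conjI R(1) allI impI)
    fix s :: real and x assume "s \<ge> 0"
    note Ts = commuting_semigroup[OF this]
    have "T s x = T s (m *\<^sub>C R x - A (T t (R x)))"
      by (simp add: R(2))
    also have "\<dots> = m *\<^sub>C T s (R x) - A (T t (T s (R x)))"
      by (simp add: commuting_with_generator_T[OF Ts t]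
          bounded_clinear_simps[OF commuting_bounded_clinear[OF Ts]])
    finally show "R (T s x) = T s (R x)"
      using R(3)[of "T s (R x)"] by simp
  qed
  define S where "S x = C (R x)" for x
  have comm_S: "commuting S"
    unfolding S_def[abs_def] by (rule commuting_compose[OF C(1) comm_R])
  note lin_S = commuting_bounded_clinear[OF comm_S]
  have left: "S (l *\<^sub>C x - A x) = x" if "x \<in> D" for x
    unfolding S_def C(2)[OF comm_R, symmetric] C(3)[OF that] by (rule R(3))
  have right_D: "A (S x) = l *\<^sub>C S x - x" if "x \<in> D" for x
    using left[OF that] commuting_generator[OF comm_S that]
    by (simp add: bounded_clinear_simps[OF lin_S] algebra_simps)
  have right: "S x \<in> D" "A (S x) = l *\<^sub>C S x - x" for x
  proof -
    \<comment> \<open>The identity for \<open>A (S x)\<close> is known on \<open>D\<close> only; it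
      extends to every \<open>x\<close> along this sequence in \<open>D\<close>.\<close>
    define z where "z n = T (inverse (real (Suc n))) x" for n
    have z: "z \<longlonglongrightarrow> x" "\<And>n. z n \<in> D"
      unfolding z_def using T_approx by (auto intro: T_in_generator_dom)
    have S_z: "(\<lambda>n. S (z n)) \<longlonglongrightarrow> S x"
      by (rule bounded_clinear_tendsto[OF lin_S z(1)])
    have AS_z: "(\<lambda>n. A (S (z n))) \<longlonglongrightarrow> l *\<^sub>C S x - x"
      unfolding right_D[OF z(2)]
      by (intro tendsto_diff bounded_clinear_tendsto[OF bounded_clinear_scaleC_right] S_z z(1))
    show "S x \<in> D" "A (S x) = l *\<^sub>C S x - x"
      using generator_closed[OF commuting_generator_dom[OF comm_S z(2)] S_z AS_z] by auto
  qed
  show ?thesis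
    by (rule resolvent_setI[of S]) (use lin_S left right in auto)
qed

text \<open>The same unit vectors serve, since the bounded factor \<open>C\<close> sends null
  sequences to null sequences.\<close>

lemma approx_point_spectrum_generator_T:
  assumes t: "t > 0" and l: "l \<in> approx_point_spectrum D A"
  shows "l * exp (l * complex_of_real t) \<in> approx_point_spectrum UNIV (\<lambda>x. A (T t x))"
proof -
  obtain C where C: "commuting C"
      "\<And>x. x \<in> D \<Longrightarrow> C (l *\<^sub>C x - A x) = (l * exp (l * complex_of_real t)) *\<^sub>C x - A (T t x)"
    using scalar_factorisation[OF t, of l] by metis
  obtain x where x: "\<And>n. x n \<in> D" "\<And>n. norm (x n) = 1" "(\<lambda>n. l *\<^sub>C x n - A (x n)) \<longlonglongrightarrow> 0"
    using l by (auto simp: approx_point_spectrum_def)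
  have "(\<lambda>n. C (l *\<^sub>C x n - A (x n))) \<longlonglongrightarrow> C 0"
    by (rule bounded_clinear_tendsto[OF commuting_bounded_clinear[OF C(1)] x(3)])
  then show ?thesis
    using x C(2) bounded_clinear_zero[OF commuting_bounded_clinear[OF C(1)]]
    by (auto simp: approx_point_spectrum_def)
qed

end

subsection \<open>The case of a nonzero value\<close>

locale eigenvalue_candidate = smooth_semigroup +
  fixes t :: real and m :: complex
  assumes t: "t > 0" and m: "m \<noteq> 0"
begin

definition B :: "'a \<Rightarrow> 'a" where "B x = A (T t x)"

text \<open>On the part of the space where \<open>B\<close> acts as \<open>m\<close>, the operator \<open>A\<close> coincides with the
  bounded operator \<open>G\<close>, because there \<open>x = B x / m\<close>.\<close>

definition G :: "'a \<Rightarrow> 'a" where "G x = inverse m *\<^sub>C A (B x)"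

text \<open>The value at \<open>G\<close> of the monic polynomial with roots \<open>as\<close>. A
  list lets the later inductions peel off one linear factor at a time.\<close>

definition root_product :: "complex list \<Rightarrow> 'a \<Rightarrow> 'a"
  where "root_product as x = foldr (\<lambda>a v. G v - a *\<^sub>C v) as x"

lemma root_product_simps [simp]:
  "root_product [] x = x"
  "root_product (a # as) x = G (root_product as x) - a *\<^sub>C root_product as x"
  by (simp_all add: root_product_def)

lemma commuting_B: "commuting B"
  unfolding B_def[abs_def] by (rule commuting_generator_T[OF t])

lemma B_in_generator_dom: "B x \<in> D"
  unfolding B_def by (rule generator_T_in_generator_dom[OF t])

lemma commuting_G: "commuting G"
proof -
  have "t / 2 > 0"
    using t by simp
  note H = commuting_generator_T[OF this]
  show ?thesis
    unfolding G_def[abs_def] B_def generator_T_in_generator_dom(2)[OF t]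
    by (rule commuting_scaleC[OF commuting_compose[OF H H]])
qed

text \<open>Splitting \<open>t\<close> into t/2, t/4 and t/4 writes \<open>A G\<close>, a multiple
  of A^3 T(t), as a product of three bounded operators.\<close>

lemma generator_G:
  shows G_in_generator_dom: "G x \<in> D" and commuting_generator_G: "commuting (\<lambda>x. A (G x))"
proof -
  have t2: "t / 2 > 0" and t4: "t / 2 / 2 > 0"
    using t by simp_all
  have in_D: "A (B x) \<in> D" for x
    unfolding B_def generator_T_in_generator_dom(2)[OF t]
    by (rule generator_T_in_generator_dom(1)[OF t2])
  show "G x \<in> D"
    unfolding G_def by (rule generator_dom_scaleC[OF in_D])
  have "A (G x) = inverse m *\<^sub>C A (T (t / 2 / 2) (A (T (t / 2 / 2) (A (T (t / 2) x)))))" for x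
    unfolding G_def generator_scaleC[OF in_D]
    unfolding B_def generator_T_in_generator_dom(2)[OF t] generator_T_in_generator_dom(2)[OF t2] ..
  then show "commuting (\<lambda>x. A (G x))"
    using commuting_scaleC[OF commuting_compose[OF commuting_generator_T[OF t4]
          commuting_compose[OF commuting_generator_T[OF t4] commuting_generator_T[OF t2]]]]
    by (simp only:)
qed

lemma commuting_with_B: "commuting V \<Longrightarrow> V (B x) = B (V x)"
  unfolding B_def by (rule commuting_with_generator_T[OF _ t])

lemma commuting_with_G:
  assumes "commuting V"
  shows "V (G x) = G (V x)"
  unfolding G_def
  using commuting_generator[OF assms B_in_generator_dom[of x]] commuting_with_B[OF assms, of x]
  by (simp add: bounded_clinear_scaleC[OF commuting_bounded_clinear[OF assms]])

text \<open>Since \<open>B\<close> and \<open>A\<close> commute on \<open>D\<close>, G - A = (B - m)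
  A / m there: modulo multiples of \<open>B - m\<close>, the bounded \<open>G\<close> replaces
  \<open>A\<close>.\<close>

lemma G_minus_generator:
  assumes "x \<in> D"
  shows "G x - A x = inverse m *\<^sub>C (B (A x) - m *\<^sub>C A x)"
  using commuting_generator[OF commuting_B assms] m
  by (simp add: G_def cvec.scale_right_diff_distrib scaleC_scaleC)

lemma commuting_root_product: "commuting (root_product as)"
proof (induction as)
  case Nil
  show ?case
    using commuting_id by (simp add: root_product_def[abs_def])
next
  case (Cons a as)
  have "commuting (\<lambda>x. G (root_product as x) - a *\<^sub>C root_product as x)"
    by (intro commuting_sub commuting_scaleC commuting_compose[OF commuting_G] Cons)
  then show ?case
    by (simp add: root_product_def[abs_def])
qed

text \<open>Let f(z) = z exp(t z) - m. Variation of constants with \<open>P = G\<close> gives f(G) =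
  Q0 (B - m), and multiplying by h(G), where f h = p, gives p(G).\<close>

lemma root_product_factorisation:
  obtains as Q where "commuting Q" "\<And>a. a \<in> set as \<Longrightarrow> a * exp (a * complex_of_real t) = m"
    "\<And>x. root_product as x = Q (B x - m *\<^sub>C x)"
proof -
  have t0: "t \<ge> 0"
    using t by simp
  note lin_G = commuting_bounded_clinear[OF commuting_G]
  obtain g where g: "g > 0" "\<And>x. norm (G x) \<le> g * norm x"
    using bounded_clinear_bound[OF lin_G] by metis
  interpret G: bounded_operator G g
    by unfold_locales (use g lin_G in auto)
  obtain J where J: "commuting J"
      "\<forall>x\<in>D. J (A x - G x) = T t x - fun_calc (fps_exp (complex_of_real t)) G x"
    using variation_of_constants[OF commuting_G t0] by blast
  define E where "E = fun_calc (fps_exp (complex_of_real t)) G"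
  define f where "f z = z * exp (complex_of_real t * z) - m" for z :: complex
  define F where "F = fps_X * fps_exp (complex_of_real t) - fps_const m"
  have "f has_fps_expansion F"
    unfolding f_def[abs_def] F_def by (intro fps_expansion_intros)
  moreover have "f holomorphic_on UNIV"
    unfolding f_def[abs_def] by (intro holomorphic_intros)
  moreover have "f 0 \<noteq> 0"
    using m by (simp add: f_def)
  ultimately obtain as H where as: "\<forall>a\<in>set as. f a = 0" and H: "fps_conv_radius H > ereal g"
      and FH: "F * H = prod_list (map (\<lambda>a. fps_X - fps_const a) as)"
    using fps_zeros_cancelled[of f F 0 g] by metis
  have inf: "fps_conv_radius (K * L) = \<infinity>" "fps_conv_radius (K - L) = \<infinity>"
    if "fps_conv_radius K = \<infinity>" "fps_conv_radius L = \<infinity>" for K L :: "complex fps"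
    using fps_conv_radius_mult[of K L] fps_conv_radius_diff[of K L] that by simp_all
  have rad_prod: "fps_conv_radius (prod_list (map (\<lambda>a. fps_X - fps_const a) as)) = \<infinity>"
    for as :: "complex list"
    by (induction as) (simp_all add: inf)
  have rad_F: "fps_conv_radius F = \<infinity>"
    by (simp add: F_def inf)
  have prod: "fun_calc (prod_list (map (\<lambda>a. fps_X - fps_const a) as)) G x = root_product as x" for as x
  proof (induction as)
    case (Cons a as)
    then show ?case
      by (simp add: G.fun_calc_mult G.fun_calc_diff G.fun_calc_X G.fun_calc_const rad_prod inf)
  qed (simp add: G.fun_calc_1)
  have E_G: "G (E x) = E (G x)" for x
    unfolding E_def using lin_G by (intro G.fun_calc_commute) auto
  have calc_F: "fun_calc F G x = E (G x) - m *\<^sub>C x" for x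
    unfolding F_def E_G[symmetric] unfolding E_def
    by (simp add: G.fun_calc_mult G.fun_calc_diff G.fun_calc_X G.fun_calc_const inf)
  define K where "K x = A (G x)" for x
  have comm_K: "commuting K"
    unfolding K_def[abs_def] by (rule commuting_generator_G)
  \<comment> \<open>From T(t) G = B^2 / m and (A - G) G = - (B - m) K / m one gets G exp(t G) - m =
    (B^2 - m^2) / m + J K (B - m) / m, from which \<open>B - m\<close> is factored out.\<close>
  define Q0 where "Q0 y = inverse m *\<^sub>C (B y + m *\<^sub>C y + J (K y))" for y
  have comm_Q0: "commuting Q0"
    unfolding Q0_def[abs_def]
    by (intro commuting_scaleC commuting_plus commuting_B commuting_id
        commuting_compose[OF J(1) comm_K])
  have calc_F': "fun_calc F G x = Q0 (B x - m *\<^sub>C x)" for x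
  proof -
    have "A (G x) - G (G x) = - (inverse m *\<^sub>C (B (K x) - m *\<^sub>C K x))"
      using G_minus_generator[OF G_in_generator_dom, of x] unfolding K_def
      by (metis minus_diff_eq)
    then have "T t (G x) - E (G x) = - (inverse m *\<^sub>C J (B (K x) - m *\<^sub>C K x))"
      using J(2)[rule_format, OF G_in_generator_dom, of x]
      by (simp add: E_def bounded_clinear_simps[OF commuting_bounded_clinear[OF J(1)]])
    moreover have "T t (G x) = inverse m *\<^sub>C B (B x)"
      using commuting_generator[OF commuting_semigroup[OF t0] B_in_generator_dom, of x]
      by (simp add: G_def B_def bounded_clinear_scaleC[OF clin_T[OF t0]])
    ultimately have "E (G x) = inverse m *\<^sub>C B (B x) + inverse m *\<^sub>C J (B (K x) - m *\<^sub>C K x)"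
      by (simp add: algebra_simps)
    moreover have "K (B x - m *\<^sub>C x) = B (K x) - m *\<^sub>C K x"
      by (simp add: bounded_clinear_simps[OF commuting_bounded_clinear[OF comm_K]]
          commuting_with_B[OF comm_K])
    moreover have "inverse m *\<^sub>C (B (B x - m *\<^sub>C x) + m *\<^sub>C (B x - m *\<^sub>C x)) =
        inverse m *\<^sub>C B (B x) - m *\<^sub>C x"
      using m by (simp add: bounded_clinear_simps[OF commuting_bounded_clinear[OF commuting_B]]
          cvec.scale_right_diff_distrib scaleC_scaleC)
    ultimately show ?thesis
      unfolding calc_F Q0_def by (simp add: cvec.scale_right_distrib)
  qed
  have comm_H: "commuting (fun_calc H G)"
    unfolding commuting_def
    using G.bounded_clinear_fun_calc[OF H] G.fun_calc_commute[OF H clin_T] commuting_T[OF commuting_G]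
    by simp
  show ?thesis
  proof (rule that)
    show "commuting (\<lambda>x. fun_calc H G (Q0 x))"
      by (rule commuting_compose[OF comm_H comm_Q0])
    show "a * exp (a * complex_of_real t) = m" if "a \<in> set as" for a
      using as that by (simp add: f_def mult.commute)
    show "root_product as x = fun_calc H G (Q0 (B x - m *\<^sub>C x))" for x
    proof -
      have "root_product as x = fun_calc (H * F) G x"
        by (simp add: prod[symmetric] FH[symmetric] mult.commute)
      then show ?thesis
        by (simp add: G.fun_calc_mult[OF H] rad_F calc_F')
    qed
  qed
qed

section \<open>From the spectra of \<open>B\<close> back to those of \<open>A\<close>\<close>

text \<open>Modulo multiples of \<open>B - m\<close> every factor G - a is invertible, because
  \<open>G\<close> agrees with \<open>A\<close> there. So p(G) is invertible modulo
  \<open>B - m\<close>; being itself a multiple of \<open>B - m\<close>, it forces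
  \<open>B - m\<close> to be invertible.\<close>

lemma resolvent_set_B:
  assumes "\<And>a. a * exp (a * complex_of_real t) = m \<Longrightarrow> a \<in> resolvent_set D A"
  shows "m \<in> resolvent_set UNIV B"
proof -
  obtain as Q where Q: "commuting Q" and roots: "\<And>a. a \<in> set as \<Longrightarrow> a * exp (a * complex_of_real t) = m"
      and prod: "\<And>x. root_product as x = Q (B x - m *\<^sub>C x)"
    using root_product_factorisation by metis
  have "\<exists>U V. commuting U \<and> commuting V \<and> (\<forall>x. U (root_product as x) = x + V (B x - m *\<^sub>C x))"
    if "set as \<subseteq> resolvent_set D A" for as
    using that
  proof (induction as)
    case Nil
    have "commuting (\<lambda>x. 0 *\<^sub>C x)"
      by (rule commuting_scaleC[OF commuting_id])
    then show ?case
      using commuting_id by (intro exI[of _ "\<lambda>x. x"] exI[of _ "\<lambda>x. 0"]) auto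
  next
    case (Cons a as)
    then obtain U V where U: "commuting U" and V: "commuting V"
        and UV: "\<And>x. U (root_product as x) = x + V (B x - m *\<^sub>C x)"
      by auto
    obtain R where R: "bounded_clinear R" "\<And>x. R x \<in> D" "\<And>x. a *\<^sub>C R x - A (R x) = x"
        "\<And>x. x \<in> D \<Longrightarrow> R (a *\<^sub>C x - A x) = x"
      using resolvent_setE[of a D A] Cons.prems by auto
    have comm_R: "commuting R"
      by (rule commuting_resolvent[OF R])
    \<comment> \<open>\<open>N\<close> is A R, written in a form that is visibly bounded.\<close>
    define N where "N y = a *\<^sub>C R y - y" for y
    have comm_N: "commuting N"
      unfolding N_def[abs_def] by (intro commuting_sub commuting_scaleC comm_R commuting_id)
    have AR: "A (R y) = N y" for y
      using R(3)[of y] by (simp add: N_def algebra_simps)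
    have R_factor: "R (G y - a *\<^sub>C y) = inverse m *\<^sub>C N (B y - m *\<^sub>C y) - y" for y
    proof -
      have "R (G y - a *\<^sub>C y) = (G (R y) - A (R y)) - (a *\<^sub>C R y - A (R y))"
        by (simp add: bounded_clinear_simps[OF R(1)] commuting_with_G[OF comm_R])
      also have "\<dots> = inverse m *\<^sub>C (B (N y) - m *\<^sub>C N y) - y"
        unfolding G_minus_generator[OF R(2)] R(3) unfolding AR ..
      finally show ?thesis
        by (simp add: commuting_with_B[OF comm_N]
            bounded_clinear_simps[OF commuting_bounded_clinear[OF comm_N]])
    qed
    define p where "p = root_product as"
    have comm_p: "commuting p"
      unfolding p_def by (rule commuting_root_product)
    \<comment> \<open>\<open>R\<close> inverts a - A, the negative of the new factor, hence the
      sign.\<close>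
    define U' where "U' y = (-1) *\<^sub>C U (R y)" for y
    define V' where "V' y = V y - inverse m *\<^sub>C U (N (p y))" for y
    have "commuting U'" "commuting V'"
      unfolding U'_def[abs_def] V'_def[abs_def]
      by (intro commuting_scaleC commuting_sub V commuting_compose[OF U] commuting_compose[OF comm_N]
          comm_p comm_R)+
    moreover have "U' (root_product (a # as) x) = x + V' (B x - m *\<^sub>C x)" for x
    proof -
      have "U' (root_product (a # as) x) = - U (inverse m *\<^sub>C N (B (p x) - m *\<^sub>C p x) - p x)"
        by (simp add: U'_def p_def R_factor)
      also have "B (p x) - m *\<^sub>C p x = p (B x - m *\<^sub>C x)"
        by (simp add: bounded_clinear_simps[OF commuting_bounded_clinear[OF comm_p]]
            commuting_with_B[OF comm_p])
      also have "- U (inverse m *\<^sub>C N (p (B x - m *\<^sub>C x)) - p x) =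
          U (p x) - inverse m *\<^sub>C U (N (p (B x - m *\<^sub>C x)))"
        by (simp add: bounded_clinear_diff[OF commuting_bounded_clinear[OF U]]
            bounded_clinear_scaleC[OF commuting_bounded_clinear[OF U]])
      also have "U (p x) = x + V (B x - m *\<^sub>C x)"
        unfolding p_def by (rule UV)
      finally show ?thesis
        by (simp add: V'_def)
    qed
    ultimately show ?case
      by blast
  qed
  moreover have "set as \<subseteq> resolvent_set D A"
    using assms roots by auto
  ultimately obtain U V where U: "commuting U" and V: "commuting V"
      and UV: "\<And>x. U (root_product as x) = x + V (B x - m *\<^sub>C x)"
    by blast
  \<comment> \<open>Inserting p(G) = Q (B - m) into \<open>UV\<close> gives (U Q - V) (B - m) = 1;
    the opposite sign inverts m - B.\<close>
  define R where "R y = V y - U (Q y)" for y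
  have comm_R: "commuting R"
    unfolding R_def[abs_def] by (intro commuting_sub V commuting_compose[OF U Q])
  note lin_R = commuting_bounded_clinear[OF comm_R]
  have left: "R (m *\<^sub>C x - B x) = x" for x
  proof -
    have "R (B x - m *\<^sub>C x) = - x"
      using UV[of x] by (simp add: R_def prod)
    then show ?thesis
      using bounded_clinear_minus[OF lin_R, of "B x - m *\<^sub>C x"] by simp
  qed
  have right: "m *\<^sub>C R x - B (R x) = x" for x
    using left[of x] by (simp add: bounded_clinear_simps[OF lin_R] commuting_with_B[OF comm_R])
  show ?thesis
    by (rule resolvent_setI[OF lin_R UNIV_I right left])
qed

text \<open>The vectors \<open>v n\<close> need not lie in \<open>D\<close>, but B v / m does; it
  differs from \<open>v\<close> by a null sequence, and \<open>A\<close> maps it exactly to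
  \<open>G v\<close>.\<close>

lemma approx_eigenvector_transfer:
  assumes v: "\<not> v \<longlonglongrightarrow> 0" "(\<lambda>n. B (v n) - m *\<^sub>C v n) \<longlonglongrightarrow> 0" "(\<lambda>n. G (v n) - a *\<^sub>C v n) \<longlonglongrightarrow> 0"
  shows "a \<in> approx_point_spectrum D A"
proof (rule approx_point_spectrumI)
  define w where "w n = inverse m *\<^sub>C B (v n)" for n
  note lin_B = commuting_bounded_clinear[OF commuting_B]
  note lin_G = commuting_bounded_clinear[OF commuting_G]
  have null: "(\<lambda>n. V (z n)) \<longlonglongrightarrow> 0" if "bounded_clinear V" "z \<longlonglongrightarrow> 0" for V :: "'a \<Rightarrow> 'a" and z :: "nat \<Rightarrow> 'a"
    using bounded_clinear_tendsto[OF that] bounded_clinear_zero[OF that(1)] by simp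
  show "w n \<in> D" for n
    unfolding w_def by (rule generator_dom_scaleC[OF B_in_generator_dom])
  have "w n - inverse m *\<^sub>C (B (v n) - m *\<^sub>C v n) = v n" for n
    using m by (simp add: w_def cvec.scale_right_diff_distrib scaleC_scaleC)
  then show "\<not> w \<longlonglongrightarrow> 0"
    using v(1) tendsto_diff[of w 0 sequentially, OF _ null[OF bounded_clinear_scaleC_right v(2), of "inverse m"]]
    by auto
  \<comment> \<open>Both residuals of \<open>v\<close> appear; the terms with G B and B G cancel by
    commutation.\<close>
  have "a *\<^sub>C w n - A (w n) = inverse m *\<^sub>C G (B (v n) - m *\<^sub>C v n) - inverse m *\<^sub>C B (G (v n) - a *\<^sub>C v n)" for n
  proof -
    have Aw: "A (w n) = G (v n)"
      unfolding w_def G_def by (rule generator_scaleC[OF B_in_generator_dom])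
    show ?thesis
      unfolding Aw using m commuting_with_G[OF commuting_B, of "v n"]
      by (simp add: w_def bounded_clinear_simps[OF lin_B] bounded_clinear_simps[OF lin_G]
          cvec.scale_right_diff_distrib scaleC_scaleC mult.commute)
  qed
  moreover have "(\<lambda>n. inverse m *\<^sub>C G (B (v n) - m *\<^sub>C v n) - inverse m *\<^sub>C B (G (v n) - a *\<^sub>C v n)) \<longlonglongrightarrow> 0 - 0"
    by (intro tendsto_diff null[OF bounded_clinear_const_scaleC[OF lin_G] v(2)]
        null[OF bounded_clinear_const_scaleC[OF lin_B] v(3)])
  ultimately show "(\<lambda>n. a *\<^sub>C w n - A (w n)) \<longlonglongrightarrow> 0"
    by simp
qed

text \<open>p(G) sends the approximate eigenvectors \<open>y\<close> of \<open>B\<close> to a null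
  sequence, although \<open>y\<close> itself is not null. Some factor G - a must therefore make a
  non-null sequence null, and this \<open>a\<close> is the root sought.\<close>

lemma approx_point_spectrum_B:
  assumes "m \<in> approx_point_spectrum UNIV B"
  shows "\<exists>a\<in>approx_point_spectrum D A. a * exp (a * complex_of_real t) = m"
proof -
  obtain as Q where Q: "commuting Q" and roots: "\<And>a. a \<in> set as \<Longrightarrow> a * exp (a * complex_of_real t) = m"
      and prod: "\<And>x. root_product as x = Q (B x - m *\<^sub>C x)"
    using root_product_factorisation by metis
  obtain y where y: "\<And>n. norm (y n) = 1" "(\<lambda>n. m *\<^sub>C y n - B (y n)) \<longlonglongrightarrow> 0"
    using assms by (auto simp: approx_point_spectrum_def)
  have y2: "(\<lambda>n. B (y n) - m *\<^sub>C y n) \<longlonglongrightarrow> 0"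
    using tendsto_minus[OF y(2)] by simp
  have null: "(\<lambda>n. V (z n)) \<longlonglongrightarrow> 0" if "commuting V" "z \<longlonglongrightarrow> 0" for V and z :: "nat \<Rightarrow> 'a"
    using bounded_clinear_tendsto[OF commuting_bounded_clinear[OF that(1)] that(2)]
      bounded_clinear_zero[OF commuting_bounded_clinear[OF that(1)]] by simp
  have y0: "\<not> y \<longlonglongrightarrow> 0"
  proof
    assume "y \<longlonglongrightarrow> 0"
    then have "(\<lambda>n. norm (y n)) \<longlonglongrightarrow> 0"
      by (rule tendsto_norm_zero)
    then show False
      by (simp add: y(1) LIMSEQ_const_iff)
  qed
  have "\<exists>a\<in>set as. a \<in> approx_point_spectrum D A" if "(\<lambda>n. root_product as (y n)) \<longlonglongrightarrow> 0" for as
    using that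
  proof (induction as)
    case Nil
    then show ?case
      using y0 by simp
  next
    case (Cons a as)
    show ?case
    proof (cases "(\<lambda>n. root_product as (y n)) \<longlonglongrightarrow> 0")
      case True
      then show ?thesis
        using Cons.IH by auto
    next
      \<comment> \<open>Here \<open>root_product as (y n)\<close> is the approximate eigenvector of
        \<open>G\<close> at \<open>a\<close>; it stays one of \<open>B\<close> at \<open>m\<close>
        by commutation.\<close>
      case False
      have "(\<lambda>n. root_product as (B (y n) - m *\<^sub>C y n)) \<longlonglongrightarrow> 0"
        by (rule null[OF commuting_root_product y2])
      then have "(\<lambda>n. B (root_product as (y n)) - m *\<^sub>C root_product as (y n)) \<longlonglongrightarrow> 0"
        by (simp add: bounded_clinear_simps[OF commuting_bounded_clinear[OF commuting_root_product]]
            commuting_with_B[OF commuting_root_product])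
      from approx_eigenvector_transfer[OF False this, of a] Cons.prems show ?thesis
        by simp
    qed
  qed
  moreover have "(\<lambda>n. root_product as (y n)) \<longlonglongrightarrow> 0"
    unfolding prod by (rule null[OF Q y2])
  ultimately show ?thesis
    using roots by blast
qed

end

theorem theorem2:
  fixes T :: "real \<Rightarrow> 'a::complex_banach \<Rightarrow> 'a" and t :: real
  assumes "differentiable_semigroup T" and "t > 0"
  defines "D \<equiv> generator_dom T" and "A \<equiv> generator T"
  shows "spectrum (comp_dom D (T t)) (A \<circ> T t) \<union> {0} =
           {l * exp (l * complex_of_real t) | l. l \<in> spectrum D A \<union> {0}} \<and>
         approx_point_spectrum (comp_dom D (T t)) (A \<circ> T t) \<union> {0} =
           {l * exp (l * complex_of_real t) | l. l \<in> approx_point_spectrum D A \<union> {0}}"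
proof -
  interpret smooth_semigroup T
    by unfold_locales (rule assms(1))
  have dom: "comp_dom D (T t) = UNIV"
    unfolding comp_dom_def D_def using T_in_generator_dom[OF assms(2)] by blast
  have AT: "A \<circ> T t = (\<lambda>x. generator T (T t x))"
    by (simp add: A_def o_def)
  have sp: "\<exists>l. m = l * exp (l * complex_of_real t) \<and> l \<in> spectrum D A"
    if "m \<noteq> 0" "m \<in> spectrum UNIV (\<lambda>x. generator T (T t x))" for m
  proof -
    interpret eigenvalue_candidate T t m
      by unfold_locales (use assms(2) that(1) in auto)
    show ?thesis
      using resolvent_set_B that(2) unfolding spectrum_def D_def A_def B_def[abs_def] by blast
  qed
  have ap: "\<exists>l. m = l * exp (l * complex_of_real t) \<and> l \<in> approx_point_spectrum D A"
    if "m \<noteq> 0" "m \<in> approx_point_spectrum UNIV (\<lambda>x. generator T (T t x))" for m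
  proof -
    interpret eigenvalue_candidate T t m
      by unfold_locales (use assms(2) that(1) in auto)
    show ?thesis
      using approx_point_spectrum_B that(2) unfolding D_def A_def B_def[abs_def] by blast
  qed
  have sp': "l * exp (l * complex_of_real t) \<in> spectrum UNIV (\<lambda>x. generator T (T t x))"
    if "l \<in> spectrum D A" for l
    using that resolvent_set_generator[OF assms(2), of l] unfolding spectrum_def D_def A_def by blast
  have ap': "l * exp (l * complex_of_real t) \<in> approx_point_spectrum UNIV (\<lambda>x. generator T (T t x))"
    if "l \<in> approx_point_spectrum D A" for l
    using that approx_point_spectrum_generator_T[OF assms(2), of l] unfolding D_def A_def by blast
  \<comment> \<open>Both equalities have this shape. The adjoined 0 comes from \<open>l = 0\<close>,
    so only nonzero \<open>m\<close> needs a preimage in \<open>S'\<close>.\<close>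
  have eq: "S \<union> {0} = {l * exp (l * complex_of_real t) | l. l \<in> S' \<union> {0}}"
    if *: "\<And>m. m \<noteq> 0 \<Longrightarrow> m \<in> S \<Longrightarrow> \<exists>l. m = l * exp (l * complex_of_real t) \<and> l \<in> S'"
      and **: "\<And>l. l \<in> S' \<Longrightarrow> l * exp (l * complex_of_real t) \<in> S" for S S' :: "complex set"
  proof -
    have "m \<in> {l * exp (l * complex_of_real t) | l. l \<in> S' \<union> {0}}" if "m \<in> S \<union> {0}" for m
    proof (cases "m = 0")
      case True
      then show ?thesis
        by (intro CollectI exI[of _ 0]) simp
    next
      case False
      then show ?thesis
        using *[of m] that by auto
    qed
    moreover have "l * exp (l * complex_of_real t) \<in> S \<union> {0}" if "l \<in> S' \<union> {0}" for l
      using that **[of l] by auto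
    ultimately show ?thesis
      by blast
  qed
  show ?thesis
    unfolding dom AT by (intro conjI eq sp sp' ap ap')
qed

end
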